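(* Let assumption (A) of the context hold and suppose that $f$ is a quadratic function with $\nabla^2f(x)\equiv\mathbf H$ for any $x\in\mathbb R^m$. Consider the variance-reduced heavy-ball SGD algorithm $$x_{k+1}=x_k-\alpha(\nabla f(x_k)+w_{k,N_k})+\beta(x_k-x_{k-1}),\qquad k\ge0,\quad x_{-1}=x_0,$$ where $\alpha=\tfrac4{(\sqrt\eta+\sqrt L)^2}$, $\beta=\big(\tfrac{\sqrt\kappa-1}{\sqrt\kappa+1}\big)^2$ with $\kappa=L/\eta$, and $N_k=\lceil\rho_3^{-(k+1)}\rceil$ with $\rho_3\in(\beta,1)$. Then for any $\iota\in(0,\sqrt{\rho_3}-\sqrt\beta)$ there exists a constant $c(\iota)$ such that for all $k\ge0$ $$\mathbb E\left[\left\|\begin{pmatrix}x_{k+1}-x^*\\ x_k-x^*\end{pmatrix}\right\|^2\right]\le c(\iota)^2\Big(2\,\mathbb E[\|x_0-x^*\|^2]+\frac{\alpha^2\nu^2}{1-(\sqrt\beta+\iota)^2/\rho_3}\Big)\rho_3^{k+1}.$$ In addition, the iteration and oracle complexity required for obtaining an $\epsilon$-solution in a mean-squared sense are respectively $\mathcal O(\sqrt\kappa\ln(1/\epsilon))$ and $\mathcal O(\sqrt\kappa/\epsilon)$.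
   Context: Problem: minimize $f(x)=\mathbb E[F(x,\boldsymbol\xi)]$ over $x\in\mathbb R^m$, where $\boldsymbol\xi$ is an $\mathbb R^d$-valued random vector and $F:\mathbb R^m\times\mathbb R^d\to\mathbb R$. Sampled gradients $\nabla F(x,\xi)$ (gradient in $x$) are available. The algorithm starts from $x_0\in\mathbb R^m$ with positive constants $\alpha,\beta$ and positive integers $N_k$ (batch sizes); $\xi_{j,k}$ ($1\le j\le N_k$, $k\ge 0$) are i.i.d. copies of $\boldsymbol\xi$; $w_{k,N_k}=\frac1{N_k}\sum_{j=1}^{N_k}\nabla F(x_k,\xi_{j,k})-\nabla f(x_k)$; and $\mathcal F_k=\sigma\{x_0,\xi_{j,t}:1\le j\le N_t,\,0\le t\le k-1\}$, so $x_k$ is $\mathcal F_k$-measurable. Assumption (A): (i) $f$ is continuously differentiable on $\mathbb R^m$ and $\|\nabla f(x)-\nabla f(x')\|\le L\|x-x'\|$ for all $x,x'$, with $L>0$; (ii) $f$ is $\eta$-strongly convex, $\eta>0$: $(\nabla f(x)-\nabla f(x'))^T(x-x')\ge\eta\|x-x'\|^2$ for all $x,x'$; (iii) there is $\nu>0$ such that for all $k\ge0$ and $1\le j\le N_k$, almost surely $\mathbb E[\nabla F(x_k,\xi_{j,k})\mid\mathcal F_k]=\nabla f(x_k)$ and $\mathbb E[\|\nabla F(x_k,\xi_{j,k})-\nabla f(x_k)\|^2\mid\mathcal F_k]\le\nu^2$. The unique minimizer of $f$ is denoted $x^*$. Iteration complexity is the number of iterations, and oracle complexity the total number of sampled gradients,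 needed to obtain an $\epsilon$-solution, i.e. $\mathbb E[\|x_k-x^*\|^2]\le\epsilon$. *)

theory Defs
  imports "HOL-Probability.Probability"
begin

definition gen_events :: "'w measure \<Rightarrow> ('w \<Rightarrow> 'a::topological_space) \<Rightarrow> 'w set set" where
  "gen_events M Y = {Y -` A \<inter> space M | A. A \<in> sets borel}"

text \<open>The sample \<open>xi j t\<close> (index in the batch, then iteration) is drawn for \<open>1 \<le> j \<le> N t\<close>.\<close>

definition history ::
  "'w measure \<Rightarrow> (nat \<Rightarrow> nat) \<Rightarrow> ('w \<Rightarrow> real^'m) \<Rightarrow> (nat \<Rightarrow> nat \<Rightarrow> 'w \<Rightarrow> real^'d) \<Rightarrow> nat \<Rightarrow> 'w measure"
where
  "history M N x0 xi k =
     sigma (space M) (gen_events M x0 \<union> (\<Union>t<k. \<Union>j\<in>{1..N t}. gen_events M (xi j t)))"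

text \<open>\<open>real_cond_exp\<close> is real-valued only, so a random vector is conditioned componentwise.\<close>

definition vec_cond_exp ::
  "'w measure \<Rightarrow> 'w measure \<Rightarrow> ('w \<Rightarrow> real^'m) \<Rightarrow> 'w \<Rightarrow> real^'m" where
  "vec_cond_exp M G Y \<omega> = (\<chi> i. real_cond_exp M G (\<lambda>\<omega>. Y \<omega> $ i) \<omega>)"

definition grad_noise ::
  "(real^'m \<Rightarrow> real^'d \<Rightarrow> real^'m) \<Rightarrow> (real^'m \<Rightarrow> real^'m) \<Rightarrow> (nat \<Rightarrow> nat) \<Rightarrow>
   (nat \<Rightarrow> nat \<Rightarrow> 'w \<Rightarrow> real^'d) \<Rightarrow> (nat \<Rightarrow> 'w \<Rightarrow> real^'m) \<Rightarrow> nat \<Rightarrow> 'w \<Rightarrow> real^'m"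
where
  "grad_noise gradF gradf N xi x k \<omega> =
     (1 / real (N k)) *\<^sub>R (\<Sum>j=1..N k. gradF (x k \<omega>) (xi j k \<omega>)) - gradf (x k \<omega>)"

text \<open>
  In \<open>stochastic_gradient\<close>, \<open>xi0\<close> is the random vector defining the objective \<open>f\<close>, \<open>xi\<close> are its
  samples and \<open>x\<close> is the sequence of iterates. The initial point \<open>x 0\<close> may be random; it is then
  square integrable and independent of the samples. Joint measurability of \<open>F\<close> makes \<open>gradF\<close>
  jointly measurable.
\<close>

locale stochastic_gradient = prob_space M
  for M :: "'w measure"
    and F :: "real^'m \<Rightarrow> real^'d \<Rightarrow> real"
    and gradF :: "real^'m \<Rightarrow> real^'d \<Rightarrow> real^'m"
    and f :: "real^'m \<Rightarrow> real"
    and gradf :: "real^'m \<Rightarrow> real^'m"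
    and xi0 :: "'w \<Rightarrow> real^'d"
    and N :: "nat \<Rightarrow> nat"
    and xi :: "nat \<Rightarrow> nat \<Rightarrow> 'w \<Rightarrow> real^'d"
    and x :: "nat \<Rightarrow> 'w \<Rightarrow> real^'m" +
  assumes F_measurable: "(\<lambda>p. F (fst p) (snd p)) \<in> borel_measurable borel"
    and xi0_measurable: "xi0 \<in> borel_measurable M"
    and F_integrable: "\<And>u. integrable M (\<lambda>\<omega>. F u (xi0 \<omega>))"
    and f_eq: "\<And>u. f u = expectation (\<lambda>\<omega>. F u (xi0 \<omega>))"
    and gradF: "\<And>u y. GDERIV (\<lambda>v. F v y) u :> gradF u y"
    and gradf: "\<And>u. GDERIV f u :> gradf u"
    and N_pos: "\<And>k. 0 < N k"
    and x0_measurable: "x 0 \<in> borel_measurable M"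
    and x0_square_integrable: "integrable M (\<lambda>\<omega>. (norm (x 0 \<omega>))\<^sup>2)"
    and xi_measurable: "\<And>j k. j \<in> {1..N k} \<Longrightarrow> xi j k \<in> borel_measurable M"
    and xi_distr: "\<And>j k. j \<in> {1..N k} \<Longrightarrow> distr M borel (xi j k) = distr M borel xi0"
    and x0_xi_indep:
      "indep_sets
         (\<lambda>i. case i of None \<Rightarrow> gen_events M (x 0) | Some (j, k) \<Rightarrow> gen_events M (xi j k))
         (insert None (Some ` {(j, k). j \<in> {1..N k}}))"

text \<open>
  The conditional second moment uses \<open>nn_cond_exp\<close> because \<open>real_cond_exp\<close> would silently turn an
  infinite value into \<open>0\<close>. \<open>L\<close> and \<open>\<eta>\<close> are any valid constants, not
  necessarily the extreme eigenvalues of the Hessian.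
\<close>

locale assumption_A = stochastic_gradient M F gradF f gradf xi0 N xi x
  for M :: "'w measure"
    and F :: "real^'m \<Rightarrow> real^'d \<Rightarrow> real"
    and gradF f gradf xi0 N xi x +
  fixes \<eta> L \<nu> :: real
  assumes L_pos: "0 < L" and eta_pos: "0 < \<eta>" and nu_pos: "0 < \<nu>"
    and gradf_continuous: "continuous_on UNIV gradf"
    and gradf_lipschitz: "\<And>u v. norm (gradf u - gradf v) \<le> L * norm (u - v)"
    and strongly_convex: "\<And>u v. \<eta> * (norm (u - v))\<^sup>2 \<le> (gradf u - gradf v) \<bullet> (u - v)"
    and unbiased: "\<And>j k. j \<in> {1..N k} \<Longrightarrow>
      AE \<omega> in M. vec_cond_exp M (history M N (x 0) xi k) (\<lambda>\<omega>. gradF (x k \<omega>) (xi j k \<omega>)) \<omega>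
        = gradf (x k \<omega>)"
    and bounded_second_moment: "\<And>j k. j \<in> {1..N k} \<Longrightarrow>
      AE \<omega> in M. nn_cond_exp M (history M N (x 0) xi k)
          (\<lambda>\<omega>. ennreal ((norm (gradF (x k \<omega>) (xi j k \<omega>) - gradf (x k \<omega>)))\<^sup>2)) \<omega>
        \<le> ennreal (\<nu>\<^sup>2)"

definition hb_alpha :: "real \<Rightarrow> real \<Rightarrow> real" where
  "hb_alpha \<eta> L = 4 / (sqrt \<eta> + sqrt L)\<^sup>2"

definition hb_beta :: "real \<Rightarrow> real" where
  "hb_beta \<kappa> = ((sqrt \<kappa> - 1) / (sqrt \<kappa> + 1))\<^sup>2"

definition hb_batch :: "real \<Rightarrow> nat \<Rightarrow> nat" where
  "hb_batch \<rho> k = nat \<lceil>(1 / \<rho>) ^ (k + 1)\<rceil>"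

definition quadratic_with_hessian ::
  "(real^'m \<Rightarrow> real) \<Rightarrow> (real^'m \<Rightarrow> real^'m) \<Rightarrow> real^'m^'m \<Rightarrow> bool" where
  "quadratic_with_hessian f gradf H \<longleftrightarrow>
     (\<exists>A b a. \<forall>u. f u = u \<bullet> (A *v u) + b \<bullet> u + a) \<and>
     (\<forall>u. (gradf has_derivative (\<lambda>h. H *v h)) (at u))"

text \<open>
  Truncated subtraction gives \<open>0 - 1 = 0\<close> on \<open>nat\<close>, so \<open>x (k - 1)\<close> below implements the convention
  that the iterate before \<open>x 0\<close> is \<open>x 0\<close> itself.
\<close>

locale vr_heavy_ball = assumption_A M F gradF f gradf xi0 "hb_batch \<rho>" xi x \<eta> L \<nu>
  for M :: "'w measure"
    and F :: "real^'m \<Rightarrow> real^'d \<Rightarrow> real"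
    and gradF f gradf xi0 xi x \<eta> L \<nu>
    and H :: "real^'m^'m"
    and \<rho> :: real
    and xstar :: "real^'m" +
  assumes quadratic: "quadratic_with_hessian f gradf H"
    and rho: "hb_beta (L / \<eta>) < \<rho>" "\<rho> < 1"
    and xstar: "is_arg_min f (\<lambda>_. True) xstar"
    and step: "\<And>k \<omega>. \<omega> \<in> space M \<Longrightarrow>
      x (Suc k) \<omega> = x k \<omega>
        - hb_alpha \<eta> L *\<^sub>R (gradf (x k \<omega>) + grad_noise gradF gradf (hb_batch \<rho>) xi x k \<omega>)
        + hb_beta (L / \<eta>) *\<^sub>R (x k \<omega> - x (k - 1) \<omega>)"

definition eps_solution ::
  "'w measure \<Rightarrow> (nat \<Rightarrow> 'w \<Rightarrow> real^'m) \<Rightarrow> real^'m \<Rightarrow> real \<Rightarrow> nat \<Rightarrow> bool" where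
  "eps_solution M x xstar \<epsilon> k \<longleftrightarrow>
     (\<integral>\<^sup>+\<omega>. ennreal ((norm (x k \<omega> - xstar))\<^sup>2) \<partial>M) \<le> ennreal \<epsilon>"

text \<open>Meaningful only if some iterate is an \<open>\<epsilon>\<close>-solution.\<close>

definition iteration_complexity ::
  "'w measure \<Rightarrow> (nat \<Rightarrow> 'w \<Rightarrow> real^'m) \<Rightarrow> real^'m \<Rightarrow> real \<Rightarrow> nat" where
  "iteration_complexity M x xstar \<epsilon> = (LEAST k. eps_solution M x xstar \<epsilon> k)"

definition oracle_complexity ::
  "'w measure \<Rightarrow> (nat \<Rightarrow> nat) \<Rightarrow> (nat \<Rightarrow> 'w \<Rightarrow> real^'m) \<Rightarrow> real^'m \<Rightarrow> real \<Rightarrow> nat" where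
  "oracle_complexity M N x xstar \<epsilon> = (\<Sum>t<iteration_complexity M x xstar \<epsilon>. N t)"

end

theory Submission
  imports Defs
begin

text \<open>With \<open>z\<^sub>k = (x\<^sub>k - x\<^sup>*, x\<^sub>k\<^sub>-\<^sub>1 - x\<^sup>*)\<close> the error evolves by \<open>z\<^sub>k\<^sub>+\<^sub>1 = T z\<^sub>k - \<alpha> (w\<^sub>k, 0)\<close> for a fixed
  linear map \<open>T\<close>. A quadratic form that \<open>T\<close> scales by exactly \<open>\<beta>\<close> gives
  \<open>|T\<^sup>n| \<le> c (\<surd>\<beta> + \<iota>)\<^sup>n\<close>, with \<open>c\<close> depending on \<open>\<iota>\<close> only. The noise \<open>w\<^sub>k\<close> is orthogonal to the
  past and its second moment is at most \<open>\<nu>\<^sup>2 / N\<^sub>k\<close>, so that \<open>V\<^sub>n(k) = E |T\<^sup>n z\<^sub>k|\<^sup>2\<close> satisfies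
  \<open>V\<^sub>n(k + 1) \<le> V\<^sub>n\<^sub>+\<^sub>1(k) + c\<^sup>2 \<alpha>\<^sup>2 \<nu>\<^sup>2 (\<surd>\<beta> + \<iota>)\<^sup>2\<^sup>n \<rho>\<^sup>k\<^sup>+\<^sup>1\<close>; induction on \<open>k\<close> gives the mean-square bound.\<close>

section \<open>Powers of the momentum map\<close>

text \<open>Polarisation: with \<open>v\<close> the rescaled image of \<open>u\<close>,
  \<open>4 * (v \<bullet> S u)\<close> is a difference of two values of the quadratic form, and the
  parallelogram law adds up the two bounds. This stands in for the spectral theorem.\<close>

lemma norm_le_of_quadratic_form_le:
  fixes S :: "'a::real_inner \<Rightarrow> 'a"
  assumes lin: "linear S" and sym: "\<And>u v. S u \<bullet> v = u \<bullet> S v"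
    and bd: "\<And>u. \<bar>u \<bullet> S u\<bar> \<le> r * (norm u)\<^sup>2"
  shows "norm (S u) \<le> r * norm u"
proof (cases "u = 0 \<or> S u = 0")
  case True
  have "0 \<le> r" if "u \<noteq> 0"
  proof -
    have "0 \<le> r * (norm u)\<^sup>2" using bd[of u] by linarith
    with that show ?thesis by (simp add: zero_le_mult_iff)
  qed
  with True linear_0[OF lin] show ?thesis by (cases "u = 0") auto
next
  case False
  \<comment> \<open>Scaling to the length of \<open>u\<close> balances the two terms of the
    parallelogram sum.\<close>
  define v where "v = (norm u / norm (S u)) *\<^sub>R S u"
  have nv: "norm v = norm u" using False by (simp add: v_def)
  have vS: "v \<bullet> S u = norm u * norm (S u)"
    using False by (simp add: v_def dot_square_norm power2_eq_square)
  have "4 * (v \<bullet> S u) = (u + v) \<bullet> S (u + v) - (u - v) \<bullet> S (u - v)"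
    using sym[of u v] linear_add[OF lin] linear_diff[OF lin]
    by (simp add: inner_simps inner_commute)
  also have "\<dots> \<le> r * (norm (u + v))\<^sup>2 + r * (norm (u - v))\<^sup>2"
    using bd[of "u + v"] bd[of "u - v"] by linarith
  also have "\<dots> = 2 * r * ((norm u)\<^sup>2 + (norm v)\<^sup>2)"
    by (simp add: power2_norm_eq_inner inner_simps inner_commute algebra_simps)
  also have "\<dots> = 4 * (r * norm u * norm u)"
    by (simp add: nv power2_eq_square)
  finally have "norm u * norm (S u) \<le> norm u * (r * norm u)"
    by (simp add: vS mult_ac)
  then show ?thesis using False by simp
qed

text \<open>The companion map of the recurrence
  \<open>y (Suc (Suc n)) = S (y (Suc n)) - \<beta> *\<^sub>R y n\<close>, acting on pairs with the
  newer value first.\<close>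

definition momentum_map :: "('a::real_vector \<Rightarrow> 'a) \<Rightarrow> real \<Rightarrow> 'a \<times> 'a \<Rightarrow> 'a \<times> 'a" where
  "momentum_map S \<beta> z = (S (fst z) - \<beta> *\<^sub>R snd z, fst z)"

lemma linear_momentum_map: "linear S \<Longrightarrow> linear (momentum_map S \<beta>)"
  by (auto simp: momentum_map_def linear_iff algebra_simps)

lemma linear_funpow:
  fixes T :: "'a::real_vector \<Rightarrow> 'a"
  assumes "linear T"
  shows "linear (T ^^ n)"
proof (induction n)
  case 0
  then show ?case by (simp add: linear_iff)
next
  case (Suc n)
  then show ?case using assms by (simp only: funpow.simps linear_compose)
qed

text \<open>The quadratic form \<open>|y\<^sub>1|\<^sup>2 - y\<^sub>1 \<bullet> S y\<^sub>0 + b\<^sup>2 |y\<^sub>0|\<^sup>2\<close> is multiplied by exactly \<open>b\<^sup>2\<close> in each step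
  and dominates \<open>|y\<^sub>1 - S y\<^sub>0 / 2|\<^sup>2\<close>; this replaces a diagonalisation of \<open>S\<close>.\<close>

lemma second_order_recurrence_bound:
  fixes S :: "'a::real_inner \<Rightarrow> 'a"
  assumes sym: "\<And>u v. S u \<bullet> v = u \<bullet> S v" and b: "0 \<le> b"
    and S: "\<And>u. norm (S u) \<le> 2 * b * norm u"
    and y: "\<And>n. y (Suc (Suc n)) = S (y (Suc n)) - b\<^sup>2 *\<^sub>R y n"
    and D: "norm (y 1) \<le> D1" "norm (y 0) \<le> D0" "D = D1 + 2 * b * D0"
  shows "norm (y n) \<le> b ^ n * D0 + real n * b ^ (n - 1) * D"
proof -
  define E where "E n = y (Suc n) \<bullet> (y (Suc n) - S (y n)) + b\<^sup>2 * (y n \<bullet> y n)" for n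
  have E_Suc: "E (Suc n) = b\<^sup>2 * E n" for n
    using sym[of "y n" "y (Suc n)"]
    by (simp add: E_def y inner_simps algebra_simps inner_commute)
  have E: "E n = (b ^ n)\<^sup>2 * E 0" for n
    by (induction n) (simp_all add: E_Suc power_mult_distrib)
  have D_nonneg: "0 \<le> D1" "0 \<le> D0"
    using D(1,2) norm_ge_zero order_trans by blast+
  have D_ge_0: "0 \<le> D" using D_nonneg b by (simp add: D(3))
  \<comment> \<open>\<open>D\<close> is large enough for its square to cover both the mixed term and
    the term \<open>b^2 * D0^2\<close>.\<close>
  have E0: "E 0 \<le> D\<^sup>2"
  proof -
    have "y 1 \<bullet> (y 1 - S (y 0)) \<le> norm (y 1) * (norm (y 1) + norm (S (y 0)))"
      by (meson mult_left_mono norm_cauchy_schwarz norm_ge_zero norm_triangle_ineq4 order_trans)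
    also have "\<dots> \<le> D1 * (D1 + 2 * b * D0)"
    proof (intro mult_mono add_mono D)
      show "norm (S (y 0)) \<le> 2 * b * D0"
        using S[of "y 0"] mult_left_mono[OF D(2), of "2 * b"] b by linarith
    qed (use D_nonneg in auto)
    finally have "y 1 \<bullet> (y 1 - S (y 0)) \<le> D1 * (D1 + 2 * b * D0)" .
    moreover have "b\<^sup>2 * (y 0 \<bullet> y 0) \<le> b\<^sup>2 * D0\<^sup>2"
      using D(2) by (intro mult_left_mono) (simp_all add: dot_square_norm power_mono)
    ultimately have "E 0 \<le> D1 * (D1 + 2 * b * D0) + b\<^sup>2 * D0\<^sup>2"
      by (simp add: E_def)
    also have "\<dots> \<le> D\<^sup>2"
      using D_nonneg b by (simp add: D(3) power2_eq_square algebra_simps)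
    finally show ?thesis .
  qed
  \<comment> \<open>Taking the square root of the dominated term leaves a first-order recursion. Its
    forcing term has the same ratio \<open>b\<close> as its homogeneous part, which produces the
    factor \<open>n\<close>.\<close>
  have step: "norm (y (Suc n)) \<le> b * norm (y n) + b ^ n * D" for n
  proof -
    have "(norm (S (y n)))\<^sup>2 \<le> (2 * b * norm (y n))\<^sup>2"
      using S by (intro power_mono) auto
    then have *: "(norm (S (y n)))\<^sup>2 / 4 \<le> b\<^sup>2 * (y n \<bullet> y n)"
      by (simp add: dot_square_norm power_mult_distrib)
    have "(norm (y (Suc n) - (1/2) *\<^sub>R S (y n)))\<^sup>2 =
        y (Suc n) \<bullet> (y (Suc n) - S (y n)) + (norm (S (y n)))\<^sup>2 / 4"
      by (simp add: power2_norm_eq_inner inner_simps inner_commute algebra_simps)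
    also have "\<dots> \<le> E n"
      using * by (simp add: E_def)
    also have "\<dots> \<le> (b ^ n * D)\<^sup>2"
      using E0 by (subst E) (simp add: power_mult_distrib mult_left_mono)
    finally have "norm (y (Suc n) - (1/2) *\<^sub>R S (y n)) \<le> b ^ n * D"
      using b D_nonneg by (meson power2_le_imp_le mult_nonneg_nonneg zero_le_power D_ge_0)
    moreover have "norm ((1/2) *\<^sub>R S (y n)) \<le> b * norm (y n)"
      using S[of "y n"] by simp
    ultimately show ?thesis
      using norm_triangle_sub[of "y (Suc n)" "(1/2) *\<^sub>R S (y n)"] by linarith
  qed
  show ?thesis
  proof (induction n)
    case 0
    then show ?case using D by simp
  next
    case (Suc n)
    have "norm (y (Suc n)) \<le> b * norm (y n) + b ^ n * D" by (rule step)
    also have "\<dots> \<le> b * (b ^ n * D0 + real n * b ^ (n - 1) * D) + b ^ n * D"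
      using Suc b by (intro add_mono mult_left_mono) auto
    also have "\<dots> = b ^ Suc n * D0 + real (Suc n) * b ^ (Suc n - 1) * D"
      \<comment> \<open>At \<open>n = 0\<close> the truncated exponent is harmless because the
        factor \<open>n\<close> vanishes.\<close>
      by (cases n) (simp_all add: algebra_simps)
    finally show ?case .
  qed
qed

text \<open>The left side is zero or a single term of the binomial expansion of the right side. It
  serves to absorb the linear factor \<open>n\<close> into a slightly larger ratio.\<close>

lemma power_bernoulli_shift:
  fixes b e :: real
  assumes "0 \<le> b" "0 \<le> e"
  shows "real n * b ^ (n - 1) * e \<le> (b + e) ^ n"
proof (induction n)
  case (Suc n)
  have "real (Suc n) * b ^ (Suc n - 1) * e = b * (real n * b ^ (n - 1) * e) + b ^ n * e"
    by (cases n) (simp_all add: algebra_simps)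
  also have "\<dots> \<le> b * (b + e) ^ n + (b + e) ^ n * e"
    using assms Suc by (intro add_mono mult_left_mono mult_right_mono power_mono) auto
  finally show ?case by (simp add: algebra_simps)
qed simp

text \<open>The 3 bounds \<open>1 + 2 * b\<close> for \<open>b \<le> 1\<close>, and the 2 collects
  the two components of a pair. The absolute value, together with division by zero giving zero,
  keeps the constant positive for every argument.\<close>

definition transient_const :: "real \<Rightarrow> real" where
  "transient_const \<iota> = 2 * (1 + 3 / \<bar>\<iota>\<bar>)"

lemma transient_const_pos: "0 < transient_const \<iota>"
  by (simp add: transient_const_def add_pos_nonneg)

text \<open>Along an orbit the second component solves the second-order recurrence and the first is
  its shift by one, so a bound on the recurrence covers both.\<close>

lemma norm_funpow_momentum_map_le:
  fixes S :: "'a::real_inner \<Rightarrow> 'a"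
  assumes sym: "\<And>u v. S u \<bullet> v = u \<bullet> S v" and b: "0 \<le> b"
    and S: "\<And>u. norm (S u) \<le> 2 * b * norm u"
    and e: "0 < e" "b + e \<le> 1"
  shows "norm ((momentum_map S (b\<^sup>2) ^^ n) z) \<le> transient_const e * (b + e) ^ n * norm z"
proof -
  let ?T = "momentum_map S (b\<^sup>2)"
  define y where "y n = snd ((?T ^^ n) z)" for n
  have fst_y: "fst ((?T ^^ n) z) = y (Suc n)" for n
    by (simp add: y_def momentum_map_def)
  have y_rec: "y (Suc (Suc n)) = S (y (Suc n)) - b\<^sup>2 *\<^sub>R y n" for n
    by (simp add: y_def momentum_map_def)
  have y0: "norm (y 0) \<le> norm z" and y1: "norm (y 1) \<le> norm z"
    using norm_snd_le[of "snd z" "fst z"] norm_fst_le[of "fst z" "snd z"]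
    by (simp_all add: y_def momentum_map_def)
  have yb: "norm (y n) \<le> (1 + 3 / e) * (b + e) ^ n * norm z" for n
  proof -
    have "norm (y n) \<le> b ^ n * norm z + real n * b ^ (n - 1) * (norm z + 2 * b * norm z)"
      by (rule second_order_recurrence_bound[OF sym b S y_rec y1 y0 refl])
    also have "\<dots> \<le> (b + e) ^ n * norm z + ((b + e) ^ n / e) * (3 * norm z)"
    proof (intro add_mono mult_mono)
      show "b ^ n \<le> (b + e) ^ n" using b e by (intro power_mono) auto
      show "real n * b ^ (n - 1) \<le> (b + e) ^ n / e"
        using power_bernoulli_shift[OF b, of e n] e by (simp add: field_simps)
      show "norm z + 2 * b * norm z \<le> 3 * norm z"
        using mult_right_mono[of b 1 "norm z"] e by simp
    qed (use b e in auto)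
    also have "\<dots> = (1 + 3 / e) * (b + e) ^ n * norm z"
      by (simp add: field_simps)
    finally show ?thesis .
  qed
  have "norm ((?T ^^ n) z) = norm (y (Suc n), y n)"
    by (metis fst_y prod.collapse y_def)
  also have "\<dots> \<le> norm (y (Suc n)) + norm (y n)"
    by (rule norm_Pair_le)
  also have "\<dots> \<le> (1 + 3 / e) * (b + e) ^ n * norm z + (1 + 3 / e) * (b + e) ^ n * norm z"
  proof (rule add_mono[OF order_trans[OF yb] yb])
    \<comment> \<open>The extra factor \<open>b + e \<le> 1\<close> of the shifted component is
      dropped.\<close>
    show "(1 + 3 / e) * (b + e) ^ Suc n * norm z \<le> (1 + 3 / e) * (b + e) ^ n * norm z"
      using b e mult_left_le_one_le[of "(b + e) ^ n" "b + e"]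
      by (intro mult_right_mono mult_left_mono) auto
  qed
  also have "\<dots> = transient_const e * (b + e) ^ n * norm z"
    using e by (simp add: transient_const_def field_simps)
  finally show ?thesis .
qed

section \<open>Square-integrable random vectors and the history of the samples\<close>

lemma Int_stable_gen_events: "Int_stable (gen_events M Y)"
  unfolding gen_events_def by (rule Int_stableI) (auto intro: exI[of _ "_ \<inter> _"])

lemma norm_add_sq_le: "(norm (u + v))\<^sup>2 \<le> 2 * (norm u)\<^sup>2 + 2 * (norm v)\<^sup>2"
  for u v :: "'a::real_normed_vector"
proof -
  have "(norm (u + v))\<^sup>2 \<le> (norm u + norm v)\<^sup>2"
    by (intro power_mono norm_triangle_ineq) simp
  also have "\<dots> \<le> 2 * (norm u)\<^sup>2 + 2 * (norm v)\<^sup>2"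
    using zero_le_power2[of "norm u - norm v"] by (simp add: power2_diff power2_sum)
  finally show ?thesis .
qed

lemma integrable_norm_sq_add:
  fixes U V :: "'w \<Rightarrow> 'a::euclidean_space"
  assumes [measurable]: "U \<in> borel_measurable M" "V \<in> borel_measurable M"
    and "integrable M (\<lambda>\<omega>. (norm (U \<omega>))\<^sup>2)" "integrable M (\<lambda>\<omega>. (norm (V \<omega>))\<^sup>2)"
  shows "integrable M (\<lambda>\<omega>. (norm (U \<omega> + V \<omega>))\<^sup>2)"
  by (rule Bochner_Integration.integrable_bound
      [of _ "\<lambda>\<omega>. 2 * (norm (U \<omega>))\<^sup>2 + 2 * (norm (V \<omega>))\<^sup>2"])
    (use assms norm_add_sq_le in auto)

lemma integrable_mult_of_sq:
  fixes U V :: "'w \<Rightarrow> real"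
  assumes [measurable]: "U \<in> borel_measurable M" "V \<in> borel_measurable M"
    and "integrable M (\<lambda>\<omega>. (U \<omega>)\<^sup>2)" "integrable M (\<lambda>\<omega>. (V \<omega>)\<^sup>2)"
  shows "integrable M (\<lambda>\<omega>. U \<omega> * V \<omega>)"
proof (rule Bochner_Integration.integrable_bound[of _ "\<lambda>\<omega>. (U \<omega>)\<^sup>2 + (V \<omega>)\<^sup>2"])
  have "\<bar>a * b\<bar> \<le> a\<^sup>2 + b\<^sup>2" for a b :: real
    using sum_squares_bound[of "\<bar>a\<bar>" "\<bar>b\<bar>"] mult_nonneg_nonneg[of "\<bar>a\<bar>" "\<bar>b\<bar>"]
    unfolding abs_mult power2_abs mult.assoc by linarith
  then show "AE \<omega> in M. norm (U \<omega> * V \<omega>) \<le> norm ((U \<omega>)\<^sup>2 + (V \<omega>)\<^sup>2)"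
    by simp
qed (use assms in auto)

lemma borel_measurable_vec_nth [measurable (raw)]:
  fixes U :: "'w \<Rightarrow> real^'m"
  shows "U \<in> borel_measurable M \<Longrightarrow> (\<lambda>\<omega>. U \<omega> $ i) \<in> borel_measurable M"
  unfolding cart_eq_inner_axis by (intro borel_measurable_inner) auto

lemma integrable_vec_nth_sq:
  fixes U :: "'w \<Rightarrow> real^'m"
  assumes [measurable]: "U \<in> borel_measurable M" and "integrable M (\<lambda>\<omega>. (norm (U \<omega>))\<^sup>2)"
  shows "integrable M (\<lambda>\<omega>. (U \<omega> $ i)\<^sup>2)"
  by (rule Bochner_Integration.integrable_bound[OF assms(2)])
    (auto intro!: power2_le_iff_abs_le[THEN iffD2] simp: component_le_norm_cart power_mono)

lemma integrable_inner_of_sq: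
  fixes U V :: "'w \<Rightarrow> real^'m"
  assumes "U \<in> borel_measurable M" "V \<in> borel_measurable M"
    and "integrable M (\<lambda>\<omega>. (norm (U \<omega>))\<^sup>2)" "integrable M (\<lambda>\<omega>. (norm (V \<omega>))\<^sup>2)"
  shows "integrable M (\<lambda>\<omega>. U \<omega> \<bullet> V \<omega>)"
  unfolding inner_vec_def inner_real_def
  using assms by (intro Bochner_Integration.integrable_sum integrable_mult_of_sq integrable_vec_nth_sq) auto

lemma integrable_norm_sq_linear:
  fixes U :: "'w \<Rightarrow> 'a::euclidean_space" and T :: "'a \<Rightarrow> 'b::euclidean_space"
  assumes T: "linear T" and U: "U \<in> borel_measurable M" "integrable M (\<lambda>\<omega>. (norm (U \<omega>))\<^sup>2)"
  shows "(\<lambda>\<omega>. T (U \<omega>)) \<in> borel_measurable M" "integrable M (\<lambda>\<omega>. (norm (T (U \<omega>)))\<^sup>2)"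
proof -
  show meas: "(\<lambda>\<omega>. T (U \<omega>)) \<in> borel_measurable M"
    by (intro measurable_compose[OF U(1)] borel_measurable_continuous_onI linear_continuous_on
        linear_conv_bounded_linear[THEN iffD1] T)
  obtain K where K: "\<And>u. norm (T u) \<le> K * norm u"
    using linear_bounded[OF T] by blast
  have "(norm (T u))\<^sup>2 \<le> K\<^sup>2 * (norm u)\<^sup>2" for u
    using power_mono[OF K[of u], of 2] by (simp add: power_mult_distrib)
  then show "integrable M (\<lambda>\<omega>. (norm (T (U \<omega>)))\<^sup>2)"
    using meas U(2)
    by (intro Bochner_Integration.integrable_bound[OF integrable_mult_right[OF U(2), of "K\<^sup>2"]]) auto
qed

lemma (in finite_measure) integrable_of_norm_sq:
  fixes U :: "'a \<Rightarrow> 'b::euclidean_space"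
  assumes [measurable]: "U \<in> borel_measurable M" and "integrable M (\<lambda>\<omega>. (norm (U \<omega>))\<^sup>2)"
  shows "integrable M U"
proof (rule Bochner_Integration.integrable_bound[of _ "\<lambda>\<omega>. 1 + (norm (U \<omega>))\<^sup>2"])
  have "a \<le> 1 + a\<^sup>2" for a :: real
    using zero_le_power2[of "a - 1"] by (simp add: power2_diff) (smt (verit) zero_le_power2)
  then show "AE \<omega> in M. norm (U \<omega>) \<le> norm (1 + (norm (U \<omega>))\<^sup>2)"
    by simp
qed (use assms in auto)

text \<open>The preimage of a rectangle is an intersection of two preimages, so the product formula
  gives equality on rectangles, and these determine the measure.\<close>

lemma (in prob_space) distr_Pair_of_indep:
  assumes X: "X \<in> measurable M S" and Y: "Y \<in> measurable M T"
    and ind: "\<And>A B. A \<in> sets S \<Longrightarrow> B \<in> sets T \<Longrightarrow>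
      prob ((X -` A \<inter> space M) \<inter> (Y -` B \<inter> space M)) = prob (X -` A \<inter> space M) * prob (Y -` B \<inter> space M)"
  shows "distr M S X \<Otimes>\<^sub>M distr M T Y = distr M (S \<Otimes>\<^sub>M T) (\<lambda>\<omega>. (X \<omega>, Y \<omega>))"
proof (rule pair_measure_eqI)
  show "sigma_finite_measure (distr M S X)" "sigma_finite_measure (distr M T Y)"
    using X Y by (auto intro!: prob_space_imp_sigma_finite prob_space_distr)
  show "sets (distr M S X \<Otimes>\<^sub>M distr M T Y) = sets (distr M (S \<Otimes>\<^sub>M T) (\<lambda>\<omega>. (X \<omega>, Y \<omega>)))"
    by (simp cong: sets_pair_measure_cong)
  fix A B assume "A \<in> sets (distr M S X)" "B \<in> sets (distr M T Y)"
  then have AB: "A \<in> sets S" "B \<in> sets T" by auto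
  have "(\<lambda>\<omega>. (X \<omega>, Y \<omega>)) -` (A \<times> B) \<inter> space M = (X -` A \<inter> space M) \<inter> (Y -` B \<inter> space M)"
    by auto
  then show "emeasure (distr M S X) A * emeasure (distr M T Y) B =
      emeasure (distr M (S \<Otimes>\<^sub>M T) (\<lambda>\<omega>. (X \<omega>, Y \<omega>))) (A \<times> B)"
    using X Y AB by (simp add: emeasure_distr measurable_Pair emeasure_eq_measure ind ennreal_mult')
qed

section \<open>Measurable gradients, the filtration of the samples and fresh samples\<close>

context stochastic_gradient
begin

text \<open>Each coordinate is the pointwise limit of difference quotients of \<open>F\<close> with
  steps \<open>1 / (n + 1)\<close>, and these are jointly measurable because \<open>F\<close>
  is.\<close>

lemma gradF_measurable: "(\<lambda>p. gradF (fst p) (snd p)) \<in> borel_measurable borel"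
proof -
  have "(\<lambda>p. gradF (fst p) (snd p) \<bullet> axis i 1) \<in> borel_measurable borel" for i
  proof (rule borel_measurable_LIMSEQ_real)
    fix p :: "(real^'m) \<times> (real^'d)"
    let ?g = "\<lambda>t. F (fst p + t *\<^sub>R axis i 1) (snd p)"
    have "((\<lambda>v. F v (snd p)) has_derivative (\<lambda>h. h \<bullet> gradF (fst p) (snd p))) (at (fst p + 0 *\<^sub>R axis i 1))"
      using gradF[of "snd p" "fst p"] by (simp add: gderiv_def)
    then have "(?g has_derivative (\<lambda>t. (t *\<^sub>R axis i 1) \<bullet> gradF (fst p) (snd p))) (at 0)"
      by (rule has_derivative_compose[rotated]) (auto intro!: derivative_eq_intros)
    then have "(?g has_field_derivative (gradF (fst p) (snd p) \<bullet> axis i 1)) (at 0)"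
      by (simp add: has_field_derivative_def inner_commute mult_commute_abs)
    then have "((\<lambda>h. (?g h - ?g 0) / h) \<longlongrightarrow> gradF (fst p) (snd p) \<bullet> axis i 1) (at 0)"
      by (simp add: DERIV_def)
    then show "(\<lambda>n. (?g (inverse (real (Suc n))) - ?g 0) / inverse (real (Suc n)))
        \<longlonglongrightarrow> gradF (fst p) (snd p) \<bullet> axis i 1"
      by (rule filterlim_compose)
        (use LIMSEQ_inverse_real_of_nat in \<open>auto simp: filterlim_at\<close>)
  next
    fix n
    have *: "(\<lambda>p. F (fst p + t *\<^sub>R axis i 1) (snd p)) \<in> borel_measurable borel" for t
    proof -
      have "(\<lambda>p::(real^'m) \<times> (real^'d). (fst p + t *\<^sub>R axis i 1, snd p)) \<in> borel_measurable borel"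
        by (intro borel_measurable_continuous_onI continuous_intros)
      from measurable_compose[OF this F_measurable] show ?thesis by simp
    qed
    show "(\<lambda>p. (F (fst p + inverse (real (Suc n)) *\<^sub>R axis i 1) (snd p) - F (fst p + 0 *\<^sub>R axis i 1) (snd p))
        / inverse (real (Suc n))) \<in> borel_measurable borel"
      by (intro borel_measurable_divide borel_measurable_diff * borel_measurable_const)
  qed
  then show ?thesis
    by (subst borel_measurable_euclidean_space) (fastforce simp: Basis_vec_def)
qed

lemma gradF_compose_measurable:
  assumes "X \<in> borel_measurable A" "Y \<in> borel_measurable A"
  shows "(\<lambda>\<omega>. gradF (X \<omega>) (Y \<omega>)) \<in> borel_measurable A"
  using measurable_compose[OF borel_measurable_Pair[OF assms] gradF_measurable] by simp

abbreviation hist :: "nat \<Rightarrow> 'w measure" where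
  "hist \<equiv> history M N (x 0) xi"

abbreviation sources :: "(nat \<times> nat) option \<Rightarrow> 'w set set" where
  "sources i \<equiv> case i of None \<Rightarrow> gen_events M (x 0) | Some (j, k) \<Rightarrow> gen_events M (xi j k)"

abbreviation past :: "nat \<Rightarrow> (nat \<times> nat) option set" where
  "past k \<equiv> insert None (Some ` {(j, t). t < k \<and> j \<in> {1..N t}})"

text \<open>Written as generated by a subfamily of the independent \<open>sources\<close>, where
  \<open>None\<close> stands for the initial point, the history becomes accessible to the grouping
  of independent families.\<close>

lemma hist_eq: "hist k = sigma (space M) (\<Union>i\<in>past k. sources i)"
  unfolding history_def by (rule arg_cong[where f = "sigma (space M)"]) auto

lemma sources_subset: "(\<Union>i\<in>J. sources i) \<subseteq> Pow (space M)"
  by (auto simp: gen_events_def split: option.splits)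

lemma space_hist [simp]: "space (hist k) = space M"
  unfolding hist_eq by (rule space_measure_of[OF sources_subset])

lemma sets_hist: "sets (hist k) = sigma_sets (space M) (\<Union>i\<in>past k. sources i)"
  unfolding hist_eq by (rule sets_measure_of[OF sources_subset])

lemma subalgebra_hist: "subalgebra M (hist k)"
proof -
  have "(\<Union>i\<in>past k. sources i) \<subseteq> sets M"
    using x0_measurable xi_measurable by (fastforce simp: gen_events_def intro: measurable_sets)
  then show ?thesis
    by (simp add: subalgebra_def sets_hist sets.sigma_sets_subset)
qed

lemma sigma_finite_subalgebra_hist: "sigma_finite_subalgebra M (hist k)"
  using subalgebra_hist finite_measure_axioms
  by (intro finite_measure_subalgebra_is_sigma_finite)
    (simp add: finite_measure_subalgebra_def finite_measure_subalgebra_axioms_def)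

lemma hist_mono: "k \<le> l \<Longrightarrow> subalgebra (hist l) (hist k)"
  unfolding subalgebra_def sets_hist by (auto intro!: sigma_sets_mono' simp del: UN_simps)

lemma x0_hist: "x 0 \<in> borel_measurable (hist k)"
proof (rule measurableI)
  fix A :: "(real^'m) set" assume "A \<in> sets borel"
  then show "x 0 -` A \<inter> space (hist k) \<in> sets (hist k)"
    unfolding sets_hist by (intro sigma_sets.Basic) (auto simp: gen_events_def)
qed simp

lemma xi_hist:
  assumes "t < k" "j \<in> {1..N t}"
  shows "xi j t \<in> borel_measurable (hist k)"
proof (rule measurableI)
  fix A :: "(real^'d) set" assume "A \<in> sets borel"
  with assms show "xi j t -` A \<inter> space (hist k) \<in> sets (hist k)"
    unfolding sets_hist
    by (intro sigma_sets.Basic UN_I[of "Some (j, t)"]) (auto simp: gen_events_def)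
qed simp

text \<open>Adjoining sample \<open>i\<close> of batch \<open>k\<close> to the past keeps its index
  set disjoint from that of sample \<open>j\<close>. Grouping the independent sources into these two
  blocks gives independent sigma-algebras.\<close>

lemma past_sample_indep:
  fixes X :: "'w \<Rightarrow> 'b::{second_countable_topology, t2_space}"
  assumes X: "X \<in> borel_measurable (hist k)" and i: "i \<in> {1..N k}" and j: "j \<in> {1..N k}"
    and "i \<noteq> j"
  shows "distr M borel (\<lambda>\<omega>. (X \<omega>, xi i k \<omega>)) \<Otimes>\<^sub>M distr M borel (xi j k) =
    distr M (borel \<Otimes>\<^sub>M borel) (\<lambda>\<omega>. ((X \<omega>, xi i k \<omega>), xi j k \<omega>))"
proof -
  let ?P = "insert (Some (i, k)) (past k)"
  let ?K = "case_bool ?P {Some (j, k)}"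
  let ?S = "sigma (space M) (\<Union>i\<in>?P. sources i)"
  have sets_S: "sets ?S = sigma_sets (space M) (\<Union>i\<in>?P. sources i)"
    by (rule sets_measure_of[OF sources_subset])
  have space_S: "space ?S = space M"
    by (rule space_measure_of[OF sources_subset])
  have "indep_sets (\<lambda>b. sigma_sets (space M) (\<Union>i\<in>?K b. sources i)) UNIV"
  proof (rule indep_sets_collect_sigma)
    show "indep_sets sources (\<Union>b. ?K b)"
      by (rule indep_sets_mono_index[OF _ x0_xi_indep])
        (use i j in \<open>auto simp: UNIV_bool split: bool.splits\<close>)
    show "disjoint_family ?K"
      using \<open>i \<noteq> j\<close> by (auto simp: disjoint_family_on_def split: bool.splits)
  qed (auto simp: Int_stable_gen_events split: option.splits)
  then have ind: "indep_set (sets ?S) (sigma_sets (space M) (gen_events M (xi j k)))"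
    unfolding indep_set_def sets_S
    by (rule arg_cong2[where f = indep_sets, THEN iffD1, rotated 2]) (auto split: bool.splits)
  have "subalgebra ?S (hist k)"
    unfolding subalgebra_def space_S sets_S sets_hist by (auto intro!: sigma_sets_mono')
  then have "X \<in> borel_measurable ?S"
    using X measurable_from_subalg by blast
  moreover have "xi i k \<in> borel_measurable ?S"
  proof (rule measurableI)
    fix A :: "(real^'d) set" assume "A \<in> sets borel"
    then show "xi i k -` A \<inter> space ?S \<in> sets ?S"
      unfolding sets_S space_S
      by (intro sigma_sets.Basic UN_I[of "Some (i, k)"]) (auto simp: gen_events_def)
  qed simp
  ultimately have Z: "(\<lambda>\<omega>. (X \<omega>, xi i k \<omega>)) \<in> borel_measurable ?S"
    by (rule borel_measurable_Pair)
  moreover have "(\<lambda>\<omega>. (X \<omega>, xi i k \<omega>)) \<in> borel_measurable M"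
    using measurable_from_subalg[OF subalgebra_hist X] xi_measurable[OF i]
    by (rule borel_measurable_Pair)
  moreover have "xi j k -` B \<inter> space M \<in> sigma_sets (space M) (gen_events M (xi j k))"
    if "B \<in> sets borel" for B
    using that by (intro sigma_sets.Basic) (auto simp: gen_events_def)
  moreover have "(\<lambda>\<omega>. (X \<omega>, xi i k \<omega>)) -` A \<inter> space M \<in> sets ?S" if "A \<in> sets borel" for A
    using measurable_sets[OF Z that] by (simp only: space_S)
  ultimately show ?thesis
    using ind xi_measurable[OF j] unfolding indep_sets2_eq
    by (intro distr_Pair_of_indep) auto
qed

end

section \<open>Orthogonality of the gradient noise\<close>

context assumption_A
begin

abbreviation noise :: "nat \<Rightarrow> nat \<Rightarrow> 'w \<Rightarrow> real^'m" where
  "noise j k \<omega> \<equiv> gradF (x k \<omega>) (xi j k \<omega>) - gradf (x k \<omega>)"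

lemma gradf_measurable: "gradf \<in> borel_measurable borel"
  by (rule borel_measurable_continuous_onI[OF gradf_continuous])

lemma noise_measurable_of:
  assumes "x k \<in> borel_measurable A" "xi j k \<in> borel_measurable A"
  shows "noise j k \<in> borel_measurable A"
  by (intro borel_measurable_diff gradF_compose_measurable assms
      measurable_compose[OF assms(1) gradf_measurable])

lemma grad_noise_eq_average:
  "grad_noise gradF gradf N xi x k = (\<lambda>\<omega>. (1 / real (N k)) *\<^sub>R (\<Sum>j=1..N k. noise j k \<omega>))"
  using N_pos[of k] by (auto simp: grad_noise_def fun_eq_iff sum_subtractf scaleR_diff_right sum_constant_scaleR simp del: sum_constant)

lemma grad_noise_measurable_of:
  assumes "x k \<in> borel_measurable A" "\<And>j. j \<in> {1..N k} \<Longrightarrow> xi j k \<in> borel_measurable A"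
  shows "grad_noise gradF gradf N xi x k \<in> borel_measurable A"
  unfolding grad_noise_eq_average
  by (intro borel_measurable_scaleR borel_measurable_const borel_measurable_sum noise_measurable_of assms)

section \<open>One iteration from an adapted, square-integrable iterate\<close>

context
  fixes k
  assumes x_hist: "x k \<in> borel_measurable (hist k)"
    and x_sq: "integrable M (\<lambda>\<omega>. (norm (x k \<omega>))\<^sup>2)"
begin

lemma x_measurable: "x k \<in> borel_measurable M"
  by (rule measurable_from_subalg[OF subalgebra_hist x_hist])

lemma noise_measurable: "j \<in> {1..N k} \<Longrightarrow> noise j k \<in> borel_measurable M"
  by (intro noise_measurable_of x_measurable xi_measurable)

text \<open>The conditional bound is integrated in the extended nonnegative reals, so that
  integrability comes out as a conclusion.\<close>

lemma noise_second_moment: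
  assumes j: "j \<in> {1..N k}"
  shows "integrable M (\<lambda>\<omega>. (norm (noise j k \<omega>))\<^sup>2)" "expectation (\<lambda>\<omega>. (norm (noise j k \<omega>))\<^sup>2) \<le> \<nu>\<^sup>2"
proof -
  interpret S: sigma_finite_subalgebra M "hist k"
    by (rule sigma_finite_subalgebra_hist)
  have meas: "(\<lambda>\<omega>. (norm (noise j k \<omega>))\<^sup>2) \<in> borel_measurable M"
    using noise_measurable[OF j] by measurable
  have "(\<integral>\<^sup>+\<omega>. ennreal ((norm (noise j k \<omega>))\<^sup>2) \<partial>M) =
      (\<integral>\<^sup>+\<omega>. nn_cond_exp M (hist k) (\<lambda>\<omega>. ennreal ((norm (noise j k \<omega>))\<^sup>2)) \<omega> \<partial>M)"
    using S.nn_cond_exp_intg[of "\<lambda>_. 1" "\<lambda>\<omega>. ennreal ((norm (noise j k \<omega>))\<^sup>2)"] meas by simp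
  also have "\<dots> \<le> (\<integral>\<^sup>+\<omega>. ennreal (\<nu>\<^sup>2) \<partial>M)"
    by (rule nn_integral_mono_AE[OF bounded_second_moment[OF j]])
  also have "\<dots> = ennreal (\<nu>\<^sup>2)"
    by (simp add: emeasure_space_1)
  finally have nn: "(\<integral>\<^sup>+\<omega>. ennreal ((norm (noise j k \<omega>))\<^sup>2) \<partial>M) \<le> ennreal (\<nu>\<^sup>2)" .
  show int: "integrable M (\<lambda>\<omega>. (norm (noise j k \<omega>))\<^sup>2)"
    by (rule integrableI_bounded) (use meas nn in \<open>auto simp: less_top[symmetric] top_unique\<close>)
  show "expectation (\<lambda>\<omega>. (norm (noise j k \<omega>))\<^sup>2) \<le> \<nu>\<^sup>2"
    using nn by (simp add: nn_integral_eq_integral[OF int])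
qed

lemma noise_nth_sq_integrable: "j \<in> {1..N k} \<Longrightarrow> integrable M (\<lambda>\<omega>. (noise j k \<omega> $ c)\<^sup>2)"
  by (intro integrable_vec_nth_sq noise_measurable noise_second_moment)

text \<open>The Lipschitz bound gives linear growth, so square integrability passes from the iterate
  to its gradient.\<close>

lemma gradf_x_integrable: "integrable M (\<lambda>\<omega>. gradf (x k \<omega>))"
proof (rule integrable_of_norm_sq)
  show meas: "(\<lambda>\<omega>. gradf (x k \<omega>)) \<in> borel_measurable M"
    by (rule measurable_compose[OF x_measurable gradf_measurable])
  have *: "(norm (gradf u))\<^sup>2 \<le> 2 * L\<^sup>2 * (norm u)\<^sup>2 + 2 * (norm (gradf 0))\<^sup>2" for u
  proof -
    have "(norm (gradf u))\<^sup>2 \<le> 2 * (norm (gradf u - gradf 0))\<^sup>2 + 2 * (norm (gradf 0))\<^sup>2"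
      using norm_add_sq_le[of "gradf u - gradf 0" "gradf 0"] by simp
    also have "(norm (gradf u - gradf 0))\<^sup>2 \<le> (L * norm u)\<^sup>2"
      using gradf_lipschitz[of u 0] by (intro power_mono) auto
    finally show ?thesis by (simp add: power_mult_distrib)
  qed
  show "integrable M (\<lambda>\<omega>. (norm (gradf (x k \<omega>)))\<^sup>2)"
    by (rule Bochner_Integration.integrable_bound
        [of _ "\<lambda>\<omega>. 2 * L\<^sup>2 * (norm (x k \<omega>))\<^sup>2 + 2 * (norm (gradf 0))\<^sup>2"])
      (use meas x_sq * in \<open>auto intro!: AE_I2\<close>)
qed

text \<open>The past factor is tested against the conditional mean of the noise, which is zero.
  Splitting this mean by linearity requires the sampled and the true gradient to be integrable
  separately.\<close>

lemma noise_past_orthogonal: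
  assumes j: "j \<in> {1..N k}" and U: "U \<in> borel_measurable (hist k)"
    and int: "integrable M (\<lambda>\<omega>. U \<omega> * noise j k \<omega> $ c)"
  shows "expectation (\<lambda>\<omega>. U \<omega> * noise j k \<omega> $ c) = 0"
proof -
  interpret S: sigma_finite_subalgebra M "hist k"
    by (rule sigma_finite_subalgebra_hist)
  have noise_int: "integrable M (noise j k)"
    using noise_measurable[OF j] noise_second_moment(1)[OF j] by (rule integrable_of_norm_sq)
  have f_int: "integrable M (\<lambda>\<omega>. gradf (x k \<omega>) $ c)"
    using integrable_inner_left[OF gradf_x_integrable, of "axis c 1"]
    by (simp add: cart_eq_inner_axis)
  have "integrable M (\<lambda>\<omega>. gradF (x k \<omega>) (xi j k \<omega>))"
    using Bochner_Integration.integrable_add[OF noise_int gradf_x_integrable] by simp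
  then have F_int: "integrable M (\<lambda>\<omega>. gradF (x k \<omega>) (xi j k \<omega>) $ c)"
    using integrable_inner_left[of "axis c 1" M "\<lambda>\<omega>. gradF (x k \<omega>) (xi j k \<omega>)"]
    by (simp add: cart_eq_inner_axis)
  have f_hist: "(\<lambda>\<omega>. gradf (x k \<omega>) $ c) \<in> borel_measurable (hist k)"
    by (intro borel_measurable_vec_nth measurable_compose[OF x_hist gradf_measurable])
  have ce: "AE \<omega> in M. real_cond_exp M (hist k) (\<lambda>\<omega>. noise j k \<omega> $ c) \<omega> = 0"
    using S.real_cond_exp_diff[OF F_int f_int] S.real_cond_exp_F_meas[OF f_int f_hist] unbiased[OF j]
    by eventually_elim (auto simp: vec_cond_exp_def vec_eq_iff)
  have "expectation (\<lambda>\<omega>. U \<omega> * noise j k \<omega> $ c) =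
      expectation (\<lambda>\<omega>. U \<omega> * real_cond_exp M (hist k) (\<lambda>\<omega>. noise j k \<omega> $ c) \<omega>)"
    by (rule S.real_cond_exp_intg(2)[OF int U, symmetric])
      (intro borel_measurable_vec_nth noise_measurable j)
  also have "\<dots> = expectation (\<lambda>_. 0)"
    by (rule integral_cong_AE)
      (use ce U in \<open>auto intro!: borel_measurable_times measurable_from_subalg[OF subalgebra_hist]\<close>)
  finally show ?thesis by simp
qed

text \<open>Integrating out the fresh sample replaces its noise by a function of the current iterate,
  which is orthogonal to the other noise.\<close>

lemma noise_batch_orthogonal:
  assumes i: "i \<in> {1..N k}" and j: "j \<in> {1..N k}" and "i \<noteq> j"
  shows "expectation (\<lambda>\<omega>. noise i k \<omega> $ c * noise j k \<omega> $ c) = 0"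
proof -
  define G where "G u y = (gradF u y - gradf u) $ c" for u y
  \<comment> \<open>Sample \<open>j\<close> is integrated against its law \<open>P\<close> with the
    pair of the iterate and sample \<open>i\<close> held fixed; \<open>h u\<close> is the resulting
    mean noise at \<open>u\<close>.\<close>
  define P where "P = distr M borel (xi j k)"
  define Z where "Z = distr M borel (\<lambda>\<omega>. (x k \<omega>, xi i k \<omega>))"
  define h where "h u = (\<integral>y. G u y \<partial>P)" for u
  let ?\<phi> = "\<lambda>p. G (fst (fst p)) (snd (fst p)) * G (fst (fst p)) (snd p)"
  note [measurable] = x_measurable xi_measurable[OF i] xi_measurable[OF j] gradf_measurable
  interpret P: prob_space P
    unfolding P_def by (rule prob_space_distr) simp
  interpret Z: prob_space Z
    unfolding Z_def by (rule prob_space_distr) simp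
  interpret PZ: pair_prob_space Z P ..
  have sets_P [measurable_cong]: "sets P = sets borel" by (simp add: P_def)
  have sets_Z [measurable_cong]: "sets Z = sets borel" by (simp add: Z_def)
  have G_comp: "(\<lambda>q. G (a q) (b q)) \<in> borel_measurable A"
    if "a \<in> borel_measurable A" "b \<in> borel_measurable A" for a b and A :: "'q measure"
    unfolding G_def
    by (intro borel_measurable_vec_nth borel_measurable_diff gradF_compose_measurable that
        measurable_compose[OF that(1) gradf_measurable])
  have "case_prod G \<in> borel_measurable (borel \<Otimes>\<^sub>M borel)"
    unfolding case_prod_beta by (intro G_comp measurable_fst measurable_snd)
  then have h_meas: "h \<in> borel_measurable borel"
    unfolding h_def
    by (intro P.borel_measurable_lebesgue_integral)
      (simp add: measurable_cong_sets[OF sets_pair_measure_cong[OF refl sets_P] refl])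
  have prod: "Z \<Otimes>\<^sub>M P = distr M (borel \<Otimes>\<^sub>M borel) (\<lambda>\<omega>. ((x k \<omega>, xi i k \<omega>), xi j k \<omega>))"
    unfolding Z_def P_def by (rule past_sample_indep[OF x_hist i j \<open>i \<noteq> j\<close>])
  have joint: "(\<lambda>\<omega>. ((x k \<omega>, xi i k \<omega>), xi j k \<omega>)) \<in> measurable M (borel \<Otimes>\<^sub>M borel)"
    by measurable
  have \<phi>_meas: "?\<phi> \<in> borel_measurable (borel \<Otimes>\<^sub>M borel)"
    by (intro borel_measurable_times G_comp) (simp_all add: borel_prod[symmetric])
  have G_x: "G (x k \<omega>) (xi j' k \<omega>) = noise j' k \<omega> $ c" for \<omega> j'
    by (simp add: G_def)
  \<comment> \<open>A product of two square-integrable factors is integrable, which permits Fubini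
    for the joint law.\<close>
  have "integrable M (\<lambda>\<omega>. noise i k \<omega> $ c * noise j k \<omega> $ c)"
    by (intro integrable_mult_of_sq borel_measurable_vec_nth noise_measurable noise_nth_sq_integrable i j)
  then have int: "integrable (Z \<Otimes>\<^sub>M P) ?\<phi>"
    unfolding prod integrable_distr_eq[OF joint \<phi>_meas] by (simp add: G_x)
  have Z_int: "integrable Z (\<lambda>p. h (fst p) * G (fst p) (snd p))"
    using PZ.integrable_fst'[OF int] by (simp add: h_def mult.commute)
  have Z_meas: "(\<lambda>p. h (fst p) * G (fst p) (snd p)) \<in> borel_measurable borel"
    by (intro borel_measurable_times G_comp measurable_compose[OF _ h_meas])
      (simp_all add: borel_prod[symmetric])
  have X_meas: "(\<lambda>\<omega>. (x k \<omega>, xi i k \<omega>)) \<in> borel_measurable M"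
    by measurable
  have "expectation (\<lambda>\<omega>. noise i k \<omega> $ c * noise j k \<omega> $ c) = integral\<^sup>L (Z \<Otimes>\<^sub>M P) ?\<phi>"
    unfolding prod integral_distr[OF joint \<phi>_meas] by (simp add: G_x)
  also have "\<dots> = (\<integral>p. h (fst p) * G (fst p) (snd p) \<partial>Z)"
    unfolding PZ.integral_fst'[OF int, symmetric] by (simp add: h_def mult.commute)
  also have "\<dots> = expectation (\<lambda>\<omega>. h (x k \<omega>) * noise i k \<omega> $ c)"
    unfolding Z_def integral_distr[OF X_meas Z_meas] by (simp add: G_x)
  also have "\<dots> = 0"
  proof (rule noise_past_orthogonal[OF i])
    show "(\<lambda>\<omega>. h (x k \<omega>)) \<in> borel_measurable (hist k)"
      by (rule measurable_compose[OF x_hist h_meas])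
    show "integrable M (\<lambda>\<omega>. h (x k \<omega>) * noise i k \<omega> $ c)"
      using Z_int unfolding Z_def integrable_distr_eq[OF X_meas Z_meas] by (simp add: G_x)
  qed
  finally show ?thesis .
qed

lemma expectation_inner_eq_0:
  fixes U V :: "'w \<Rightarrow> real^'m"
  assumes "\<And>c. integrable M (\<lambda>\<omega>. U \<omega> $ c * V \<omega> $ c)" "\<And>c. expectation (\<lambda>\<omega>. U \<omega> $ c * V \<omega> $ c) = 0"
  shows "expectation (\<lambda>\<omega>. U \<omega> \<bullet> V \<omega>) = 0"
  unfolding inner_vec_def inner_real_def using assms by simp

lemma grad_noise_past_orthogonal:
  fixes U :: "'w \<Rightarrow> real^'m"
  assumes U: "U \<in> borel_measurable (hist k)" "integrable M (\<lambda>\<omega>. (norm (U \<omega>))\<^sup>2)"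
  shows "expectation (\<lambda>\<omega>. U \<omega> \<bullet> grad_noise gradF gradf N xi x k \<omega>) = 0"
proof -
  have UM: "U \<in> borel_measurable M"
    by (rule measurable_from_subalg[OF subalgebra_hist U(1)])
  have int: "integrable M (\<lambda>\<omega>. U \<omega> $ c * noise j k \<omega> $ c)" if "j \<in> {1..N k}" for j c
    using that UM U(2) by (intro integrable_mult_of_sq borel_measurable_vec_nth noise_measurable
        noise_nth_sq_integrable integrable_vec_nth_sq)
  have "expectation (\<lambda>\<omega>. U \<omega> \<bullet> noise j k \<omega>) = 0" if "j \<in> {1..N k}" for j
    by (intro expectation_inner_eq_0 int noise_past_orthogonal borel_measurable_vec_nth U(1) that)
  moreover have "integrable M (\<lambda>\<omega>. U \<omega> \<bullet> noise j k \<omega>)" if "j \<in> {1..N k}" for j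
    using that UM U(2) by (intro integrable_inner_of_sq noise_measurable noise_second_moment)
  ultimately show ?thesis
    unfolding grad_noise_eq_average inner_scaleR_right inner_sum_right
    by (simp only: integral_mult_right_zero Bochner_Integration.integral_sum) simp
qed

text \<open>The square expands into a double sum over the batch. Off-diagonal means vanish, and the
  \<open>N k\<close> diagonal ones, each at most \<open>\<nu>\<^sup>2\<close>, meet the factor
  \<open>1 / (N k)\<^sup>2\<close>.\<close>

lemma grad_noise_second_moment:
  shows "integrable M (\<lambda>\<omega>. (norm (grad_noise gradF gradf N xi x k \<omega>))\<^sup>2)" (is ?int)
    and "expectation (\<lambda>\<omega>. (norm (grad_noise gradF gradf N xi x k \<omega>))\<^sup>2) \<le> \<nu>\<^sup>2 / real (N k)" (is ?bd)
proof -
  let ?J = "{1..N k}"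
  have eq: "(norm (grad_noise gradF gradf N xi x k \<omega>))\<^sup>2 =
      (1 / (real (N k))\<^sup>2) * (\<Sum>i\<in>?J. \<Sum>j\<in>?J. noise i k \<omega> \<bullet> noise j k \<omega>)" for \<omega>
    unfolding grad_noise_eq_average norm_scaleR power_mult_distrib power2_norm_eq_inner
      inner_sum_left inner_sum_right by (simp add: power_divide inner_commute)
  have int: "integrable M (\<lambda>\<omega>. noise i k \<omega> \<bullet> noise j k \<omega>)" if "i \<in> ?J" "j \<in> ?J" for i j
    using that by (intro integrable_inner_of_sq noise_measurable noise_second_moment)
  show ?int
    unfolding eq by (intro integrable_mult_right Bochner_Integration.integrable_sum int)
  have cross: "expectation (\<lambda>\<omega>. noise i k \<omega> \<bullet> noise j k \<omega>) \<le> (if i = j then \<nu>\<^sup>2 else 0)"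
    if "i \<in> ?J" "j \<in> ?J" for i j
  proof (cases "i = j")
    case True
    then show ?thesis using noise_second_moment(2)[OF that(1)] by (simp add: power2_norm_eq_inner)
  next
    case False
    then have "expectation (\<lambda>\<omega>. noise i k \<omega> \<bullet> noise j k \<omega>) = 0"
      using that by (intro expectation_inner_eq_0 noise_batch_orthogonal integrable_mult_of_sq
          borel_measurable_vec_nth noise_measurable noise_nth_sq_integrable)
    with False show ?thesis by simp
  qed
  have "expectation (\<lambda>\<omega>. (norm (grad_noise gradF gradf N xi x k \<omega>))\<^sup>2) =
      (1 / (real (N k))\<^sup>2) * (\<Sum>i\<in>?J. \<Sum>j\<in>?J. expectation (\<lambda>\<omega>. noise i k \<omega> \<bullet> noise j k \<omega>))"
    unfolding eq integral_mult_right_zero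
    by (simp only: Bochner_Integration.integral_sum Bochner_Integration.integrable_sum int
        cong: sum.cong)
  also have "\<dots> \<le> (1 / (real (N k))\<^sup>2) * (\<Sum>i\<in>?J. \<Sum>j\<in>?J. if i = j then \<nu>\<^sup>2 else 0)"
    by (intro mult_left_mono sum_mono cross) auto
  also have "\<dots> = \<nu>\<^sup>2 / real (N k)"
    by (simp add: power2_eq_square)
  finally show ?bd .
qed

end

end

section \<open>Mean-square error and complexity\<close>

text \<open>The ceiling at most doubles a number that is at least 1, and the geometric sum
  telescopes after multiplication by \<open>1 - \<rho>\<close>. That factor is later paired with
  \<open>\<theta> \<le> (1 - \<rho>) * s\<close>.\<close>

lemma sum_hb_batch_le:
  assumes "0 < \<rho>" "\<rho> < 1"
  shows "(1 - \<rho>) * real (\<Sum>t<K. hb_batch \<rho> t) \<le> 2 * (1 / \<rho>) ^ K"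
proof (induction K)
  case (Suc K)
  have ge: "1 \<le> (1 / \<rho>) ^ (K + 1)"
    using assms by (intro one_le_power) simp
  have "real (hb_batch \<rho> K) \<le> (1 / \<rho>) ^ (K + 1) + 1"
    using ge unfolding hb_batch_def by linarith
  also have "\<dots> \<le> 2 * (1 / \<rho>) ^ (K + 1)" using ge by simp
  finally have "(1 - \<rho>) * real (hb_batch \<rho> K) \<le> (1 - \<rho>) * (2 * (1 / \<rho>) ^ (K + 1))"
    using assms by (intro mult_left_mono) auto
  also have "\<dots> = 2 * (1 / \<rho>) ^ Suc K - 2 * (1 / \<rho>) ^ K"
    using assms by (simp add: field_simps)
  finally show ?case using Suc by (simp add: distrib_left)
qed simp

text \<open>The iterate preceding the first \<open>\<epsilon>\<close>-solution is not one, which turns the geometric error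
  bound into \<open>\<epsilon> < B \<rho>\<^sup>K\<close>; this bounds both \<open>K\<close> and the batch sizes used up to \<open>K\<close>.\<close>

lemma complexity_of_geometric_bound:
  fixes B :: real
  assumes \<rho>: "0 < \<rho>" "\<rho> < 1" and B: "0 < B" and \<theta>: "0 < \<theta>" "\<theta> \<le> (1 - \<rho>) * s"
    and \<epsilon>: "0 < \<epsilon>" "\<epsilon> < 1" "\<epsilon> \<le> 1 / B"
    and P: "\<And>k. B * \<rho> ^ (k + 1) \<le> \<epsilon> \<Longrightarrow> P k" and K: "K = (LEAST k. P k)"
  shows "\<exists>k. P k" "real K \<le> 2 / \<theta> * (s * ln (1 / \<epsilon>))"
    "real (\<Sum>t<K. hb_batch \<rho> t) \<le> 2 / \<theta> * B * (s / \<epsilon>)"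
proof -
  have s: "0 < s"
    using \<theta> \<rho> by (smt (verit) mult_nonneg_nonpos)
  have ln_pos: "0 < ln (1 / \<epsilon>)" using \<epsilon> by simp
  show "\<exists>k. P k"
  proof -
    obtain n where "\<rho> ^ n < \<epsilon> / B"
      using real_arch_pow_inv[of "\<epsilon> / B" \<rho>] \<epsilon> B \<rho> by auto
    moreover have "\<rho> ^ (n + 1) \<le> \<rho> ^ n"
      using \<rho> by (intro power_decreasing) auto
    ultimately have "\<rho> ^ (n + 1) \<le> \<epsilon> / B" by linarith
    then have "B * \<rho> ^ (n + 1) \<le> \<epsilon>"
      using B by (simp add: field_simps)
    then show ?thesis using P by blast
  qed
  have last: "(1 / \<rho>) ^ K < B / \<epsilon>" if "K \<noteq> 0"
  proof -
    have "\<not> P (K - 1)"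
      using that by (metis K not_less_Least diff_less neq0_conv zero_less_one)
    then have "\<epsilon> < B * \<rho> ^ K"
      using P[of "K - 1"] that by force
    then show ?thesis
      using \<rho> \<epsilon> by (simp add: power_one_over field_simps)
  qed
  show "real K \<le> 2 / \<theta> * (s * ln (1 / \<epsilon>))"
  proof (cases "K = 0")
    case True
    then show ?thesis using s ln_pos \<theta> by simp
  next
    case False
    have "ln ((1 / \<rho>) ^ K) < ln (B / \<epsilon>)"
      using last[OF False] \<rho> by (simp add: ln_less_cancel_iff B \<epsilon>)
    then have "real K * ln (1 / \<rho>) \<le> ln (B / \<epsilon>)"
      using \<rho> by (simp add: ln_realpow)
    also have "\<dots> = ln B + ln (1 / \<epsilon>)"
      using B \<epsilon> by (simp add: ln_div)
    \<comment> \<open>Smallness of \<epsilon> against \<open>1 / B\<close> absorbs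
      \<open>ln B\<close> at the price of a factor 2.\<close>
    also have "ln B \<le> ln (1 / \<epsilon>)"
      using B \<epsilon> by (simp add: field_simps)
    finally have "real K * ln (1 / \<rho>) \<le> 2 * ln (1 / \<epsilon>)" by simp
    \<comment> \<open>This passes from the logarithmic rate to the gap \<open>1 - \<rho>\<close>,
      which \<theta> controls.\<close>
    moreover have "1 - \<rho> \<le> ln (1 / \<rho>)"
      using ln_le_minus_one[of \<rho>] \<rho> by (simp add: ln_div)
    ultimately have "real K * (1 - \<rho>) \<le> 2 * ln (1 / \<epsilon>)"
      by (smt (verit) mult_left_mono of_nat_0_le_iff)
    then have "real K * (1 - \<rho>) * s \<le> 2 * ln (1 / \<epsilon>) * s"
      using s by (intro mult_right_mono) auto
    moreover have "real K * \<theta> \<le> real K * ((1 - \<rho>) * s)"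
      using \<theta> by (intro mult_left_mono) auto
    ultimately show ?thesis using \<theta> by (simp add: field_simps)
  qed
  show "real (\<Sum>t<K. hb_batch \<rho> t) \<le> 2 / \<theta> * B * (s / \<epsilon>)"
  proof (cases "K = 0")
    case True
    then show ?thesis using s B \<theta> \<epsilon> by simp
  next
    case False
    let ?S = "real (\<Sum>t<K. hb_batch \<rho> t)"
    have "\<theta> * ?S \<le> (1 - \<rho>) * s * ?S"
      using \<theta> by (intro mult_right_mono) (auto intro: sum_nonneg)
    also have "\<dots> = s * ((1 - \<rho>) * ?S)" by simp
    also have "\<dots> \<le> s * (2 * (B / \<epsilon>))"
      using sum_hb_batch_le[OF \<rho>, of K] last[OF False] s by (intro mult_left_mono) auto
    finally show ?thesis using \<theta> \<epsilon> by (simp add: field_simps)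
  qed
qed

lemma hb_batch_ge: "(1 / \<rho>) ^ (k + 1) \<le> real (hb_batch \<rho> k)"
  unfolding hb_batch_def by linarith

text \<open>Uniqueness of derivatives, applied first to \<open>f\<close> and then to
  \<open>gradf\<close>, identifies \<open>H\<close> with \<open>A\<close> plus its
  transpose.\<close>

lemma quadratic_with_hessian_symmetric:
  fixes f :: "real^'m \<Rightarrow> real"
  assumes "quadratic_with_hessian f gradf H" and grad: "\<And>u. GDERIV f u :> gradf u"
  shows "(H *v u) \<bullet> v = u \<bullet> (H *v v)"
proof -
  obtain A b a where f: "\<And>u. f u = u \<bullet> (A *v u) + b \<bullet> u + a"
    and H: "\<And>u. (gradf has_derivative (\<lambda>h. H *v h)) (at u)"
    using assms(1) unfolding quadratic_with_hessian_def by blast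
  have g: "gradf u = A *v u + transpose A *v u + b" for u
  proof -
    have "(f has_derivative (\<lambda>h. u \<bullet> (A *v h) + h \<bullet> (A *v u) + b \<bullet> h)) (at u)"
      unfolding f[abs_def]
      by (auto intro!: derivative_eq_intros bounded_linear.has_derivative[OF matrix_vector_mul_bounded_linear])
    then have "(\<lambda>h. h \<bullet> gradf u) = (\<lambda>h. u \<bullet> (A *v h) + h \<bullet> (A *v u) + b \<bullet> h)"
      using grad[of u] unfolding gderiv_def by (rule has_derivative_unique[rotated])
    then have "h \<bullet> gradf u = h \<bullet> (A *v u + transpose A *v u + b)" for h
      by (simp add: fun_eq_iff inner_add_right dot_lmul_matrix[symmetric] inner_commute)
    then show ?thesis
      using vector_eq_ldot[of "gradf u" "A *v u + transpose A *v u + b"] by blast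
  qed
  have "(gradf has_derivative (\<lambda>h. A *v h + transpose A *v h)) (at 0)"
    unfolding g[abs_def]
    by (intro has_derivative_add_const[OF bounded_linear_imp_has_derivative] bounded_linear_add
        matrix_vector_mul_bounded_linear)
  then have "(\<lambda>h. H *v h) = (\<lambda>h. A *v h + transpose A *v h)"
    using H[of 0] by (rule has_derivative_unique[rotated])
  then have "H *v h = A *v h + transpose A *v h" for h
    by (rule fun_cong)
  then show ?thesis
    by (simp add: inner_simps dot_lmul_matrix[symmetric] inner_commute)
qed

section \<open>The Hessian and the heavy-ball parameters\<close>

context vr_heavy_ball
begin

lemma H_symmetric: "(H *v u) \<bullet> v = u \<bullet> (H *v v)"
  by (rule quadratic_with_hessian_symmetric[OF quadratic gradf])

lemma gradf_xstar: "gradf xstar = 0"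
proof -
  have "\<forall>y. f xstar \<le> f y"
    using xstar by (auto simp: is_arg_min_def not_less)
  then have "(\<lambda>h. h \<bullet> gradf xstar) = (\<lambda>h. 0)"
    using gradf[of xstar] differential_zero_maxmin[of xstar UNIV f "\<lambda>h. h \<bullet> gradf xstar"]
    by (simp add: gderiv_def)
  then have "gradf xstar \<bullet> gradf xstar = 0" by (rule fun_cong)
  then show ?thesis by simp
qed

text \<open>\<open>gradf\<close> minus the linear map of \<open>H\<close> has zero derivative, hence
  is constant; the vanishing gradient at the minimiser fixes the constant.\<close>

lemma gradf_eq: "gradf u = H *v (u - xstar)"
proof -
  have "((\<lambda>v. gradf v - H *v v) has_derivative (\<lambda>h. 0)) (at v within UNIV)" for v
    using quadratic unfolding quadratic_with_hessian_def
    by (auto intro!: derivative_eq_intros bounded_linear.has_derivative[OF matrix_vector_mul_bounded_linear])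
  then obtain c where c: "\<And>v. gradf v - H *v v = c"
    using has_derivative_zero_constant[of UNIV "\<lambda>v. gradf v - H *v v"] by auto
  show ?thesis
    using c[of u] c[of xstar] gradf_xstar by (simp add: matrix_vector_mult_diff_distrib) (metis diff_eq_eq add.commute uminus_add_conv_diff)
qed

text \<open>Strong convexity and the Lipschitz bound are read off between \<open>xstar + u\<close>
  and \<open>xstar\<close>; Cauchy-Schwarz turns the latter into a bound on the form.\<close>

lemma H_form_bounds: "\<eta> * (norm u)\<^sup>2 \<le> u \<bullet> (H *v u)" "u \<bullet> (H *v u) \<le> L * (norm u)\<^sup>2"
proof -
  show "\<eta> * (norm u)\<^sup>2 \<le> u \<bullet> (H *v u)"
    using strongly_convex[of "xstar + u" xstar] by (simp add: gradf_eq inner_commute)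
  have "norm (H *v u) \<le> L * norm u"
    using gradf_lipschitz[of "xstar + u" xstar] by (simp add: gradf_eq)
  then have "norm u * norm (H *v u) \<le> norm u * (L * norm u)"
    by (intro mult_left_mono) auto
  then show "u \<bullet> (H *v u) \<le> L * (norm u)\<^sup>2"
    using norm_cauchy_schwarz[of u "H *v u"] by (simp add: power2_eq_square mult_ac)
qed

text \<open>Both bounds are compared at a unit vector. Hence \<kappa> \<ge> 1, which removes the
  absolute value from the square root of \<beta> in \<open>b_eq\<close>.\<close>

lemma eta_le_L: "\<eta> \<le> L"
  using H_form_bounds[of "axis undefined 1"] by simp

definition b :: real where "b = sqrt (hb_beta (L / \<eta>))"

lemma b_eq: "b = (sqrt L - sqrt \<eta>) / (sqrt L + sqrt \<eta>)"
proof -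
  have pos: "0 < sqrt \<eta>" "sqrt \<eta> \<le> sqrt L" using eta_pos eta_le_L by auto
  have "(s / t - 1) / (s / t + 1) = (s - t) / (s + t)" if "0 < t" "t \<le> s" for s t :: real
    using that by (simp add: divide_simps)
  from this[OF pos]
  have "(sqrt (L / \<eta>) - 1) / (sqrt (L / \<eta>) + 1) = (sqrt L - sqrt \<eta>) / (sqrt L + sqrt \<eta>)"
    by (simp only: real_sqrt_divide)
  moreover have "0 \<le> (sqrt L - sqrt \<eta>) / (sqrt L + sqrt \<eta>)"
    using pos by (intro divide_nonneg_pos; linarith)
  ultimately show ?thesis
    unfolding b_def hb_beta_def by (simp only: real_sqrt_abs abs_of_nonneg)
qed

lemma b_nonneg: "0 \<le> b"
  by (simp add: b_def hb_beta_def)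

lemma hb_beta_eq: "hb_beta (L / \<eta>) = b\<^sup>2"
  unfolding b_def by (rule real_sqrt_pow2[symmetric]) (simp add: hb_beta_def)

lemma alpha_pos: "0 < hb_alpha \<eta> L"
proof -
  have "0 < sqrt \<eta> + sqrt L" using eta_pos L_pos by (intro add_pos_pos) auto
  then show ?thesis by (simp add: hb_alpha_def)
qed

lemma alpha_eta: "hb_alpha \<eta> L * \<eta> = (1 - b)\<^sup>2"
  and alpha_L: "hb_alpha \<eta> L * L = (1 + b)\<^sup>2"
proof -
  have pos: "sqrt L + sqrt \<eta> \<noteq> 0" using eta_pos L_pos by (smt (verit) real_sqrt_gt_zero)
  have "1 - b = 2 * sqrt \<eta> / (sqrt L + sqrt \<eta>)" "1 + b = 2 * sqrt L / (sqrt L + sqrt \<eta>)"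
    using pos by (simp_all add: b_eq field_simps)
  then show "hb_alpha \<eta> L * \<eta> = (1 - b)\<^sup>2" "hb_alpha \<eta> L * L = (1 + b)\<^sup>2"
    using eta_pos L_pos by (simp_all add: hb_alpha_def power_divide power_mult_distrib add.commute)
qed

text \<open>Collecting terms in the update, the current error is hit by this map and the previous
  one by the factor \<open>- b\<^sup>2\<close>.\<close>

definition S :: "real^'m \<Rightarrow> real^'m" where
  "S u = (1 + b\<^sup>2) *\<^sub>R u - hb_alpha \<eta> L *\<^sub>R (H *v u)"

lemma linear_S: "linear S"
  by (rule linearI)
    (simp_all add: S_def matrix_vector_right_distrib matrix_vector_mult_scaleR algebra_simps)

lemma S_symmetric: "S u \<bullet> v = u \<bullet> S v"
  by (simp add: S_def inner_simps H_symmetric)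

text \<open>The step size and momentum parameter are chosen such that \<open>\<alpha> \<eta> = (1 - \<surd>\<beta>)\<^sup>2\<close> and
  \<open>\<alpha> L = (1 + \<surd>\<beta>)\<^sup>2\<close>, so that the spectrum of \<open>S\<close> lies in \<open>[-2\<surd>\<beta>, 2\<surd>\<beta>]\<close>.\<close>

lemma norm_S_le: "norm (S u) \<le> 2 * b * norm u"
proof (rule norm_le_of_quadratic_form_le[OF linear_S S_symmetric])
  fix u :: "real^'m"
  let ?n = "(norm u)\<^sup>2"
  have eq: "u \<bullet> S u = (1 + b\<^sup>2) * ?n - hb_alpha \<eta> L * (u \<bullet> (H *v u))"
    by (simp add: S_def inner_simps power2_norm_eq_inner)
  have "hb_alpha \<eta> L * (\<eta> * ?n) \<le> hb_alpha \<eta> L * (u \<bullet> (H *v u))"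
    "hb_alpha \<eta> L * (u \<bullet> (H *v u)) \<le> hb_alpha \<eta> L * (L * ?n)"
    using H_form_bounds[of u] alpha_pos by (auto intro!: mult_left_mono)
  then have "(1 - b)\<^sup>2 * ?n \<le> hb_alpha \<eta> L * (u \<bullet> (H *v u))"
    "hb_alpha \<eta> L * (u \<bullet> (H *v u)) \<le> (1 + b)\<^sup>2 * ?n"
    by (simp_all only: mult.assoc[symmetric] alpha_eta alpha_L)
  then show "\<bar>u \<bullet> S u\<bar> \<le> 2 * b * ?n"
    unfolding eq by (simp add: abs_le_iff power2_sum power2_diff algebra_simps)
qed

section \<open>The error pairs and their regularity\<close>

abbreviation T :: "(real^'m) \<times> (real^'m) \<Rightarrow> (real^'m) \<times> (real^'m)" where
  "T \<equiv> momentum_map S (b\<^sup>2)"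

abbreviation w :: "nat \<Rightarrow> 'w \<Rightarrow> real^'m" where
  "w \<equiv> grad_noise gradF gradf (hb_batch \<rho>) xi x"

text \<open>At \<open>k = 0\<close> both components equal \<open>x 0 - xstar\<close>, which is the
  source of the factor 2 before the initial error.\<close>

definition z :: "nat \<Rightarrow> 'w \<Rightarrow> (real^'m) \<times> (real^'m)" where
  "z k \<omega> = (x k \<omega> - xstar, x (k - 1) \<omega> - xstar)"

lemma linear_T: "linear (T ^^ n)"
  by (intro linear_funpow linear_momentum_map linear_S)

lemma z_Suc:
  assumes "\<omega> \<in> space M"
  shows "z (Suc k) \<omega> = T (z k \<omega>) - hb_alpha \<eta> L *\<^sub>R (w k \<omega>, 0)"
  using step[OF assms, of k]
  by (simp add: z_def momentum_map_def S_def gradf_eq hb_beta_eq algebra_simps)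

lemma x_meas_of_z:
  assumes "z k \<in> borel_measurable A"
  shows "x k \<in> borel_measurable A"
proof -
  have "x k = (\<lambda>\<omega>. fst (z k \<omega>) + xstar)" by (simp add: z_def fun_eq_iff)
  moreover have "(\<lambda>\<omega>. fst (z k \<omega>) + xstar) \<in> borel_measurable A"
    by (intro borel_measurable_add borel_measurable_const measurable_compose[OF assms]
        borel_measurable_continuous_onI continuous_intros)
  ultimately show ?thesis by simp
qed

lemma x_sq_of_z:
  assumes "z k \<in> borel_measurable M" "integrable M (\<lambda>\<omega>. (norm (z k \<omega>))\<^sup>2)"
  shows "integrable M (\<lambda>\<omega>. (norm (x k \<omega>))\<^sup>2)"
  using integrable_norm_sq_add[OF integrable_norm_sq_linear(1)[OF linear_fst assms] borel_measurable_const
      integrable_norm_sq_linear(2)[OF linear_fst assms], of xstar]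
  by (simp add: z_def)

text \<open>Both properties go through one induction, because the noise estimates for step
  \<open>k\<close> take both as hypotheses on \<open>x k\<close>.\<close>

lemma z_regular: "z k \<in> borel_measurable (hist k) \<and> integrable M (\<lambda>\<omega>. (norm (z k \<omega>))\<^sup>2)"
proof (induction k)
  case 0
  have lin: "linear (\<lambda>u::real^'m. (u, u))" by (rule linearI) auto
  have "integrable M (\<lambda>\<omega>. (norm (x 0 \<omega> + - xstar))\<^sup>2)"
    by (rule integrable_norm_sq_add) (use x0_measurable x0_square_integrable in auto)
  from integrable_norm_sq_linear(2)[OF lin _ this] x0_measurable
  have "integrable M (\<lambda>\<omega>. (norm (z 0 \<omega>))\<^sup>2)"
    by (simp add: z_def borel_measurable_diff)
  moreover have "z 0 \<in> borel_measurable (hist 0)"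
    unfolding z_def[abs_def] by (simp add: borel_measurable_Pair borel_measurable_diff x0_hist)
  ultimately show ?case by simp
next
  case (Suc k)
  then have zh: "z k \<in> borel_measurable (hist k)" and zi: "integrable M (\<lambda>\<omega>. (norm (z k \<omega>))\<^sup>2)"
    by auto
  have zM: "z k \<in> borel_measurable M"
    by (rule measurable_from_subalg[OF subalgebra_hist zh])
  have zh': "z k \<in> borel_measurable (hist (Suc k))"
    by (rule measurable_from_subalg[OF hist_mono zh]) simp
  have wh: "w k \<in> borel_measurable (hist (Suc k))"
    by (intro grad_noise_measurable_of x_meas_of_z zh' xi_hist) auto
  have wM: "w k \<in> borel_measurable M"
    by (rule measurable_from_subalg[OF subalgebra_hist wh])
  have wi: "integrable M (\<lambda>\<omega>. (norm (w k \<omega>))\<^sup>2)"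
    by (intro grad_noise_second_moment(1) x_meas_of_z zh x_sq_of_z zM zi)
  have T1: "linear T" and inj: "linear (\<lambda>u::real^'m. - (hb_alpha \<eta> L *\<^sub>R (u, 0::real^'m)))"
    using linear_T[of 1] by (auto simp: linear_iff algebra_simps)
  let ?z = "\<lambda>\<omega>. T (z k \<omega>) + - (hb_alpha \<eta> L *\<^sub>R (w k \<omega>, 0))"
  have eq: "z (Suc k) \<omega> = ?z \<omega>" if "\<omega> \<in> space M" for \<omega>
    using z_Suc[OF that] by simp
  have meas: "?z \<in> borel_measurable A" if "z k \<in> borel_measurable A" "w k \<in> borel_measurable A" for A
    by (intro borel_measurable_add measurable_compose[OF that(1)] measurable_compose[OF that(2)]
      borel_measurable_continuous_onI linear_continuous_on linear_conv_bounded_linear[THEN iffD1] T1 inj)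
  have "z (Suc k) \<in> borel_measurable (hist (Suc k))"
    by (subst measurable_cong[OF eq]) (use meas[OF zh' wh] in auto)
  moreover have "integrable M (\<lambda>\<omega>. (norm (?z \<omega>))\<^sup>2)"
    by (intro integrable_norm_sq_add integrable_norm_sq_linear[OF T1 zM zi] integrable_norm_sq_linear[OF inj wM wi])
  then have "integrable M (\<lambda>\<omega>. (norm (z (Suc k) \<omega>))\<^sup>2)"
    by (subst Bochner_Integration.integrable_cong[OF refl]) (use eq in auto)
  ultimately show ?case by blast
qed

lemma z_hist: "z k \<in> borel_measurable (hist k)"
  and z_sq: "integrable M (\<lambda>\<omega>. (norm (z k \<omega>))\<^sup>2)"
  by (rule z_regular[THEN conjunct1], rule z_regular[THEN conjunct2])

lemma z_measurable: "z k \<in> borel_measurable M"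
  by (rule measurable_from_subalg[OF subalgebra_hist z_hist])

lemma x_hist: "x k \<in> borel_measurable (hist k)"
  by (rule x_meas_of_z[OF z_hist])

lemma x_sq: "integrable M (\<lambda>\<omega>. (norm (x k \<omega>))\<^sup>2)"
  by (rule x_sq_of_z[OF z_measurable z_sq])

lemma w_measurable: "w k \<in> borel_measurable M"
  using measurable_from_subalg[OF subalgebra_hist x_hist] xi_measurable
  by (rule grad_noise_measurable_of)

section \<open>The mean-square bound for a fixed margin \<iota>\<close>

context
  fixes \<iota> :: real
  assumes iota: "0 < \<iota>" "\<iota> < sqrt \<rho> - b"
begin

definition r where "r = b + \<iota>"

lemma rho_pos: "0 < \<rho>"
  by (rule le_less_trans[OF _ rho(1)]) (simp add: hb_beta_eq)

lemma r_pos: "0 < r"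
  using iota b_nonneg by (simp add: r_def)

lemma r_sq_less: "r\<^sup>2 < \<rho>"
proof -
  have "r\<^sup>2 < (sqrt \<rho>)\<^sup>2"
    using iota r_pos by (intro power_strict_mono) (auto simp: r_def)
  then show ?thesis using rho_pos by simp
qed

lemma r_le_1: "r \<le> 1"
proof (rule power2_le_imp_le)
  show "r\<^sup>2 \<le> 1\<^sup>2" using r_sq_less rho(2) by simp
qed simp

lemma norm_T_le: "norm ((T ^^ n) u) \<le> transient_const \<iota> * r ^ n * norm u"
  unfolding r_def
  by (rule norm_funpow_momentum_map_le[OF S_symmetric b_nonneg norm_S_le])
    (use iota r_le_1 in \<open>auto simp: r_def\<close>)

lemma norm_T_sq_le: "(norm ((T ^^ n) u))\<^sup>2 \<le> (transient_const \<iota>)\<^sup>2 * (r\<^sup>2) ^ n * (norm u)\<^sup>2"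
  using power_mono[OF norm_T_le[of n u], of 2]
  by (simp add: power_mult_distrib power_mult[symmetric] mult.commute)

text \<open>Carrying the exponent \<open>n\<close> lets one iteration trade a unit of
  \<open>k\<close> for a unit of \<open>n\<close>, so the induction closes without unrolling
  \<open>z k\<close> into a sum over all earlier noise.\<close>

definition V :: "nat \<Rightarrow> nat \<Rightarrow> real" where
  "V n k = expectation (\<lambda>\<omega>. (norm ((T ^^ n) (z k \<omega>)))\<^sup>2)"

text \<open>On expanding the square, the cross term has mean zero by orthogonality to the past; the
  power estimate and the batch size bound what the noise leaves.\<close>

lemma V_Suc_le:
  "V n (Suc k) \<le> V (Suc n) k + (transient_const \<iota>)\<^sup>2 * ((hb_alpha \<eta> L)\<^sup>2 * \<nu>\<^sup>2) * (r\<^sup>2) ^ n * \<rho> ^ Suc k"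
proof -
  let ?a = "hb_alpha \<eta> L" and ?c = "(transient_const \<iota>)\<^sup>2"
  let ?A = "\<lambda>\<omega>. (T ^^ Suc n) (z k \<omega>)" and ?B = "\<lambda>\<omega>. (T ^^ n) (w k \<omega>, 0)"
  \<comment> \<open>The adjoint moves \<open>T ^^ n\<close> off the noise, and only the first
    component matters since the noise enters only there. The cross term thus becomes a
    history-measurable vector against \<open>w k\<close>.\<close>
  define U where "U = fst \<circ> (adjoint (T ^^ n) \<circ> (T ^^ Suc n))"
  have lin_U: "linear U"
    unfolding U_def
    by (rule linear_compose[OF linear_compose[OF linear_T adjoint_linear[OF linear_T]] linear_fst])
  have inj: "linear (\<lambda>u::real^'m. (T ^^ n) (u, 0))"
    by (rule linear_compose[OF _ linear_T, unfolded o_def]) (simp add: linear_iff)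
  have inner: "?A \<omega> \<bullet> ?B \<omega> = U (z k \<omega>) \<bullet> w k \<omega>" for \<omega>
    using adjoint_works[OF linear_T[of n], of "(w k \<omega>, 0)" "?A \<omega>"]
    by (simp add: U_def inner_prod_def inner_commute)
  have U_hist: "(\<lambda>\<omega>. U (z k \<omega>)) \<in> borel_measurable (hist k)"
    by (intro measurable_compose[OF z_hist] borel_measurable_continuous_onI linear_continuous_on
        linear_conv_bounded_linear[THEN iffD1] lin_U)
  note U_sq = integrable_norm_sq_linear[OF lin_U z_measurable z_sq]
  note w_sq = grad_noise_second_moment[OF x_hist x_sq]
  have A_int: "integrable M (\<lambda>\<omega>. (norm (?A \<omega>))\<^sup>2)"
    by (rule integrable_norm_sq_linear[OF linear_T z_measurable z_sq])
  have B_int: "integrable M (\<lambda>\<omega>. (norm (?B \<omega>))\<^sup>2)"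
    by (rule integrable_norm_sq_linear[OF inj w_measurable w_sq(1)])
  have C_int: "integrable M (\<lambda>\<omega>. ?A \<omega> \<bullet> ?B \<omega>)"
    unfolding inner by (rule integrable_inner_of_sq[OF U_sq(1) w_measurable U_sq(2) w_sq(1)])
  have C_0: "expectation (\<lambda>\<omega>. ?A \<omega> \<bullet> ?B \<omega>) = 0"
    unfolding inner by (rule grad_noise_past_orthogonal[OF x_hist x_sq U_hist U_sq(2)])
  have expand: "(norm ((T ^^ n) (z (Suc k) \<omega>)))\<^sup>2 =
      (norm (?A \<omega>))\<^sup>2 - 2 * ?a * (?A \<omega> \<bullet> ?B \<omega>) + ?a\<^sup>2 * (norm (?B \<omega>))\<^sup>2" if "\<omega> \<in> space M" for \<omega>
  proof -
    have "(T ^^ n) (z (Suc k) \<omega>) = ?A \<omega> - ?a *\<^sub>R ?B \<omega>"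
      by (simp only: z_Suc[OF that] linear_diff[OF linear_T] linear_scale[OF linear_T] funpow_Suc_right o_apply)
    then show ?thesis
      by (simp only: power2_norm_eq_inner) (simp add: inner_simps inner_commute power2_eq_square)
  qed
  have V_eq: "V n (Suc k) = V (Suc n) k + ?a\<^sup>2 * expectation (\<lambda>\<omega>. (norm (?B \<omega>))\<^sup>2)"
  proof -
    have "V n (Suc k) = expectation (\<lambda>\<omega>. (norm (?A \<omega>))\<^sup>2 - 2 * ?a * (?A \<omega> \<bullet> ?B \<omega>) + ?a\<^sup>2 * (norm (?B \<omega>))\<^sup>2)"
      unfolding V_def by (rule Bochner_Integration.integral_cong[OF refl expand])
    also have "\<dots> = V (Suc n) k + ?a\<^sup>2 * expectation (\<lambda>\<omega>. (norm (?B \<omega>))\<^sup>2)"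
      unfolding V_def using A_int B_int C_int C_0
      by (simp only: Bochner_Integration.integral_add Bochner_Integration.integral_diff
          Bochner_Integration.integrable_diff integrable_mult_right integral_mult_right_zero)
    finally show ?thesis .
  qed
  have "expectation (\<lambda>\<omega>. (norm (?B \<omega>))\<^sup>2) \<le> expectation (\<lambda>\<omega>. ?c * (r\<^sup>2) ^ n * (norm (w k \<omega>))\<^sup>2)"
    using norm_T_sq_le[of n "(_, 0)"]
    by (intro integral_mono B_int integrable_mult_right w_sq(1)) (simp add: norm_Pair)
  also have "\<dots> \<le> ?c * (r\<^sup>2) ^ n * (\<nu>\<^sup>2 * \<rho> ^ Suc k)"
  proof -
    \<comment> \<open>The growing batches alone supply the decay \<open>\<rho> ^ Suc k\<close> of
      the noise.\<close>
    have "1 / real (hb_batch \<rho> k) \<le> 1 / (1 / \<rho>) ^ (k + 1)"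
      using rho_pos by (intro divide_left_mono hb_batch_ge mult_pos_pos) (simp_all add: N_pos)
    then have "\<nu>\<^sup>2 * (1 / real (hb_batch \<rho> k)) \<le> \<nu>\<^sup>2 * \<rho> ^ Suc k"
      by (intro mult_left_mono) (auto simp: power_one_over)
    then have "expectation (\<lambda>\<omega>. (norm (w k \<omega>))\<^sup>2) \<le> \<nu>\<^sup>2 * \<rho> ^ Suc k"
      using w_sq(2)[of k] by simp
    then show ?thesis
      by (simp only: integral_mult_right_zero) (intro mult_left_mono, auto)
  qed
  finally have "?a\<^sup>2 * expectation (\<lambda>\<omega>. (norm (?B \<omega>))\<^sup>2) \<le> ?a\<^sup>2 * (?c * (r\<^sup>2) ^ n * (\<nu>\<^sup>2 * \<rho> ^ Suc k))"
    by (intro mult_left_mono) auto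
  then show ?thesis
    unfolding V_eq by (simp add: mult_ac)
qed

text \<open>The denominator comes from a geometric series of ratio
  \<open>r\<^sup>2 / \<rho>\<close>, which is below 1 because \<iota> stays below
  \<open>sqrt \<rho> - b\<close>.\<close>

definition B :: real where
  "B = (transient_const \<iota>)\<^sup>2 * (2 * expectation (\<lambda>\<omega>. (norm (x 0 \<omega> - xstar))\<^sup>2)
    + (hb_alpha \<eta> L)\<^sup>2 * \<nu>\<^sup>2 / (1 - r\<^sup>2 / \<rho>))"

lemma B_pos: "0 < B"
proof -
  have "r\<^sup>2 / \<rho> < 1" using r_sq_less rho_pos by simp
  then show ?thesis
    unfolding B_def using transient_const_pos[of \<iota>] alpha_pos nu_pos
    by (intro mult_pos_pos add_nonneg_pos divide_pos_pos) (auto intro!: Bochner_Integration.integral_nonneg)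
qed

text \<open>The induction on \<open>k\<close> keeps \<open>n\<close> arbitrary since its step
  appeals to \<open>Suc n\<close>; the surplus factor \<open>r\<^sup>2\<close> is split as
  \<open>?q * \<rho>\<close>.\<close>

lemma V_le: "V n k \<le> (r\<^sup>2) ^ n * \<rho> ^ k * B"
proof (induction k arbitrary: n)
  case 0
  let ?c = "(transient_const \<iota>)\<^sup>2"
  have z0: "(norm (z 0 \<omega>))\<^sup>2 = 2 * (norm (x 0 \<omega> - xstar))\<^sup>2" for \<omega>
    by (simp add: z_def norm_Pair)
  have "V n 0 \<le> expectation (\<lambda>\<omega>. ?c * (r\<^sup>2) ^ n * (norm (z 0 \<omega>))\<^sup>2)"
    unfolding V_def
    by (intro integral_mono norm_T_sq_le integrable_mult_right z_sq
        integrable_norm_sq_linear[OF linear_T z_measurable z_sq])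
  also have "\<dots> = (r\<^sup>2) ^ n * (?c * (2 * expectation (\<lambda>\<omega>. (norm (x 0 \<omega> - xstar))\<^sup>2)))"
    unfolding z0 by simp
  also have "\<dots> \<le> (r\<^sup>2) ^ n * B"
    unfolding B_def using r_sq_less rho_pos by (intro mult_left_mono) auto
  finally show ?case by simp
next
  case (Suc k)
  let ?q = "r\<^sup>2 / \<rho>"
  let ?a = "(transient_const \<iota>)\<^sup>2 * ((hb_alpha \<eta> L)\<^sup>2 * \<nu>\<^sup>2)"
  have q: "?q < 1" using r_sq_less rho_pos by simp
  \<comment> \<open>The noise part of \<open>B\<close> is \<open>?a / (1 - ?q)\<close>, the fixed
    point of scaling by \<open>?q\<close> and adding \<open>?a\<close>. The nonnegative initial part
    only helps, whence \<open>?q * B + ?a \<le> B\<close>.\<close>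
  have "c * a = d * (c * (a / d))" if "d \<noteq> 0" for c a d :: real
    using that by simp
  from this[of "1 - ?q"] q have "?a = (1 - ?q) * ((transient_const \<iota>)\<^sup>2 * ((hb_alpha \<eta> L)\<^sup>2 * \<nu>\<^sup>2 / (1 - ?q)))"
    by fastforce
  also have "\<dots> \<le> (1 - ?q) * B"
    unfolding B_def using q by (intro mult_left_mono) (auto intro!: Bochner_Integration.integral_nonneg)
  finally have fixpt: "?q * B + ?a \<le> B" by (simp add: algebra_simps)
  have "V n (Suc k) \<le> (r\<^sup>2) ^ Suc n * \<rho> ^ k * B + ?a * (r\<^sup>2) ^ n * \<rho> ^ Suc k"
    using V_Suc_le[of n k] Suc[of "Suc n"] by linarith
  also have "\<dots> = (r\<^sup>2) ^ n * \<rho> ^ Suc k * (?q * B + ?a)"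
    using rho_pos by (simp add: field_simps)
  also have "\<dots> \<le> (r\<^sup>2) ^ n * \<rho> ^ Suc k * B"
    using fixpt rho_pos by (intro mult_left_mono) auto
  finally show ?case .
qed

text \<open>This is the case \<open>n = 0\<close> at time \<open>k + 1\<close>; in the extended
  integral the bound includes finiteness.\<close>

lemma mean_square_bound:
  "(\<integral>\<^sup>+\<omega>. ennreal ((norm (x (k + 1) \<omega> - xstar, x k \<omega> - xstar))\<^sup>2) \<partial>M) \<le> ennreal (B * \<rho> ^ (k + 1))"
proof -
  have "(\<integral>\<^sup>+\<omega>. ennreal ((norm (z (k + 1) \<omega>))\<^sup>2) \<partial>M) = ennreal (V 0 (k + 1))"
    by (simp add: V_def nn_integral_eq_integral[OF z_sq])
  also have "\<dots> \<le> ennreal (B * \<rho> ^ (k + 1))"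
    using V_le[of 0 "k + 1"] by (intro ennreal_leI) (simp add: mult.commute)
  finally show ?thesis by (simp add: z_def)
qed

text \<open>\<open>x k\<close> is the second component of the pair at time \<open>k + 1\<close>, so
  it inherits the exponent \<open>k + 1\<close>.\<close>

lemma eps_solution_of_bound:
  assumes "B * \<rho> ^ (k + 1) \<le> \<epsilon>"
  shows "eps_solution M x xstar \<epsilon> k"
proof -
  have "(\<integral>\<^sup>+\<omega>. ennreal ((norm (x k \<omega> - xstar))\<^sup>2) \<partial>M) \<le>
      (\<integral>\<^sup>+\<omega>. ennreal ((norm (x (k + 1) \<omega> - xstar, x k \<omega> - xstar))\<^sup>2) \<partial>M)"
    by (intro nn_integral_mono ennreal_leI power_mono norm_snd_le) auto
  also note mean_square_bound
  also have "ennreal (B * \<rho> ^ (k + 1)) \<le> ennreal \<epsilon>"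
    by (rule ennreal_leI[OF assms])
  finally show ?thesis by (simp add: eps_solution_def)
qed

text \<open>The threshold for \<epsilon> depends on \<open>B\<close>, which keeps \<open>B\<close>
  out of the iteration count.\<close>

lemma complexity:
  assumes \<theta>: "0 < \<theta>" "\<theta> \<le> (1 - \<rho>) * sqrt (L / \<eta>)"
  shows "\<forall>\<^sub>F \<epsilon> in at_right 0.
    (\<exists>k. eps_solution M x xstar \<epsilon> k) \<and>
    real (iteration_complexity M x xstar \<epsilon>) \<le> 2 / \<theta> * (sqrt (L / \<eta>) * ln (1 / \<epsilon>)) \<and>
    real (oracle_complexity M (hb_batch \<rho>) x xstar \<epsilon>) \<le> 2 / \<theta> * B * (sqrt (L / \<eta>) / \<epsilon>)"
proof -
  have "\<forall>\<^sub>F \<epsilon> in at_right 0. \<epsilon> \<in> {0<..<min 1 (1 / B)}"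
    by (rule eventually_at_right_real) (use B_pos in simp)
  then show ?thesis
  proof (rule eventually_mono)
    fix \<epsilon> :: real assume \<epsilon>: "\<epsilon> \<in> {0<..<min 1 (1 / B)}"
    note c = complexity_of_geometric_bound[OF rho_pos rho(2) B_pos \<theta> _ _ _ eps_solution_of_bound
        iteration_complexity_def, of \<epsilon>]
    show "(\<exists>k. eps_solution M x xstar \<epsilon> k) \<and>
      real (iteration_complexity M x xstar \<epsilon>) \<le> 2 / \<theta> * (sqrt (L / \<eta>) * ln (1 / \<epsilon>)) \<and>
      real (oracle_complexity M (hb_batch \<rho>) x xstar \<epsilon>) \<le> 2 / \<theta> * B * (sqrt (L / \<eta>) / \<epsilon>)"
      unfolding oracle_complexity_def using c \<epsilon> by simp
  qed
qed

end

end

text \<open>The lower bound \<theta> on \<open>(1 - \<rho>) * sqrt \<kappa>\<close> is what turns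
  the rate \<rho> into the factor \<open>sqrt \<kappa>\<close> of both complexities. As
  \<open>C\<close> is chosen before the problem data, it depends on \<theta> alone.\<close>

theorem proposition3:
  shows "\<exists>c :: real^'m^'m \<Rightarrow> real \<Rightarrow> real \<Rightarrow> real \<Rightarrow> real.
    (\<forall>H \<eta> L \<iota>. 0 < c H \<eta> L \<iota>) \<and>
    (\<forall>\<theta>>0. \<exists>C>0.
      \<forall>(M :: 'w measure) (F :: real^'m \<Rightarrow> real^'d \<Rightarrow> real) gradF f gradf xi0 xi x \<eta> L \<nu> H \<rho> xstar \<iota>.
        vr_heavy_ball M F gradF f gradf xi0 xi x \<eta> L \<nu> H \<rho> xstar \<and>
        0 < \<iota> \<and> \<iota> < sqrt \<rho> - sqrt (hb_beta (L / \<eta>)) \<longrightarrow>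
        (let \<kappa> = L / \<eta>; \<alpha> = hb_alpha \<eta> L; \<beta> = hb_beta \<kappa>;
             B = (c H \<eta> L \<iota>)\<^sup>2 *
                 (2 * (\<integral>\<omega>. (norm (x 0 \<omega> - xstar))\<^sup>2 \<partial>M)
                  + \<alpha>\<^sup>2 * \<nu>\<^sup>2 / (1 - (sqrt \<beta> + \<iota>)\<^sup>2 / \<rho>))
         in (\<forall>k. (\<integral>\<^sup>+\<omega>. ennreal ((norm (x (k + 1) \<omega> - xstar, x k \<omega> - xstar))\<^sup>2) \<partial>M)
                   \<le> ennreal (B * \<rho> ^ (k + 1))) \<and>
            (\<theta> \<le> (1 - \<rho>) * sqrt \<kappa> \<longrightarrow>
              (\<forall>\<^sub>F \<epsilon> in at_right 0.
                (\<exists>k. eps_solution M x xstar \<epsilon> k) \<and>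
                real (iteration_complexity M x xstar \<epsilon>) \<le> C * (sqrt \<kappa> * ln (1 / \<epsilon>)) \<and>
                real (oracle_complexity M (hb_batch \<rho>) x xstar \<epsilon>) \<le> C * B * (sqrt \<kappa> / \<epsilon>)))))"
proof (intro exI[of _ "\<lambda>H \<eta> L. transient_const"] conjI allI impI, goal_cases)
  case 1
  show ?case by (rule transient_const_pos)
next
  case (2 \<theta>)
  show ?case
  \<comment> \<open>The 2 in this constant comes from absorbing \<open>ln B\<close> in the iteration
    count and from the ceilings in the sample count.\<close>
  proof (intro exI[of _ "2 / \<theta>"] conjI allI impI, goal_cases)
    case 1
    with 2 show ?case by simp
  next
    case (2 M F gradF f gradf xi0 xi x \<eta> L \<nu> H \<rho> xstar \<iota>)
    then interpret vr_heavy_ball M F gradF f gradf xi0 xi x \<eta> L \<nu> H \<rho> xstar by blast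
    have iota: "0 < \<iota>" "\<iota> < sqrt \<rho> - b" using 2 by (auto simp: b_def)
    show ?case
      using mean_square_bound[OF iota] complexity[OF iota \<open>0 < \<theta>\<close>]
      unfolding B_def[OF iota] r_def[OF iota] b_def Let_def by blast
  qed
qed

end
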